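(* Let $a,d,c$ be positive integers and $k\ge2$ an integer with $\gcd(a,a+d,\ldots,a+kd,c)=1$, and let $\mathcal{S}=\langle a,a+d,\ldots,a+kd,c\rangle$. Then $\mathcal{S}$ is pseudo-symmetric if and only if $\gcd(a,d)=1$ and one of the following holds: (a) $\mathcal{S}=\langle3,3+d,3+2d\rangle$ (as sets); (b) $a(c-1)=2(c+d)$ with $c$ odd; (c.1) $a\equiv1$ or $5\pmod 6$, $c(a-3)=6d$, and $a\le 2kd+3$; (c.2) there exist integers $\lambda\ge1$, $\mu\ge1$, $n\ge1$ such that $a=(2+\lambda k)(n+1)+1$, $c+(2+\lambda k)d=\mu a$, and $a+kd=\dfrac{cn-3d}{\lambda}$; (d) there exist integers $\lambda\ge2$, $\mu\ge1$, $v\ge0$ such that $a=(v+1)(2+(\lambda-2)k)+(\lambda k+1)$, $c+(2+(\lambda-2)k)d=\mu a$, and $a+kd=\dfrac{c(v+1)-d}{\lambda}$; (e) there exist integers $q_1\ge2$, $R_0\equiv2\pmod k$ and $s_0\equiv2\pmod k$ such that $a=(q_1-1)s_0+1$, $a+kd=q_1R_0+2k-1$, and $kc=(R_0+2k-1)(s_0-1)+2k-1$; (f) there exist integers $q_1\ge2$, $R_0\equiv2\pmod k$ and $s_0\equiv2\pmod k$ with $s_0\ne2$ such that $a=(q_1-1)s_0+3$, $a+kd=q_1R_0+1$, and $kc=(R_0+1)(s_0-3)+3$.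
   Context: $\langle b_1,\ldots,b_t\rangle$ denotes the numerical semigroup of non-negative integer combinations of $b_1,\ldots,b_t$. For a numerical semigroup $\mathcal{S}$ with Frobenius number $g$ (largest integer not in $\mathcal{S}$), $\mathcal{S}$ is pseudo-symmetric if $g$ is even and $\mathcal{S}\cup(g-\mathcal{S})=\mathbb{Z}\setminus\{g/2\}$, where $g-\mathcal{S}=\{g-s:s\in\mathcal{S}\}$. *)

theory Defs
  imports Main "HOL-Number_Theory.Cong"
begin

inductive_set num_semigroup :: "int set \<Rightarrow> int set" for B :: "int set" where
  zero: "0 \<in> num_semigroup B"
| add: "s \<in> num_semigroup B \<Longrightarrow> b \<in> B \<Longrightarrow> s + b \<in> num_semigroup B"

definition frobenius :: "int set \<Rightarrow> int" where
  "frobenius S = (GREATEST x. x \<notin> S)"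

definition pseudo_symmetric :: "int set \<Rightarrow> bool" where
  "pseudo_symmetric S \<longleftrightarrow>
     (let g = frobenius S in
       even g \<and> S \<union> {g - s | s. s \<in> S} = UNIV - {g div 2})"

end

theory Submission
  imports Defs
begin

text \<open>If \<open>gcd a d > 1\<close>, an exceptional element \<open>F / 2\<close> would come with translates by multiples of
  \<open>c\<close> that are exceptional as well. If \<open>gcd a d = 1\<close>, the Apery set of \<open>S\<close> with respect to \<open>a\<close> is
  the injective image, under \<open>(y, z) \<mapsto> a \<lceil>y / k\<rceil> + d y + c z\<close>, of an L-shaped set of lattice
  points, whose largest value \<open>F + a\<close> sits at one of the two outer corners. The reflection
  \<open>q \<mapsto> corner - q\<close>, taken modulo the lattice, splits the L-shape into two rectangles with an
  involution on each, and \<open>S\<close> is pseudo-symmetric iff the values at \<open>q\<close> and at its mirror image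
  add up to \<open>F + a\<close> for all \<open>q\<close> but one, where the sum is \<open>F + 2 a\<close>. Away from the corner at
  \<open>(2, 0)\<close> (cases (a) and (b)), the exceptional point must be the centre of the rectangle not
  containing the origin. That rectangle has height one because the sum does not depend on the second
  coordinate. Comparing the rounding errors at the
  centre and next to it leaves two shapes for each corner: (c) and (d), resp. (e) and (f).\<close>

section \<open>Generated semigroups\<close>

abbreviation (input) aa_gens :: "int \<Rightarrow> int \<Rightarrow> int \<Rightarrow> int \<Rightarrow> int set" where
  "aa_gens a d c k \<equiv> {a + i * d | i. 0 \<le> i \<and> i \<le> k} \<union> {c}"

lemma num_semigroup_generator: "b \<in> B \<Longrightarrow> b \<in> num_semigroup B"
  using num_semigroup.add[OF num_semigroup.zero] by force

lemma num_semigroup_add: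
  assumes "x \<in> num_semigroup B" "y \<in> num_semigroup B"
  shows "x + y \<in> num_semigroup B"
  using assms(2)
proof induction
  case zero
  then show ?case using assms(1) by simp
next
  case (add s b)
  then show ?case using num_semigroup.add[of "x + s" B b] by (simp add: add.assoc)
qed

lemma num_semigroup_mult:
  assumes "x \<in> num_semigroup B" "0 \<le> n"
  shows "n * x \<in> num_semigroup B"
  using assms(2)
proof (induction n rule: int_ge_induct)
  case base
  then show ?case by (simp add: num_semigroup.zero)
next
  case (step n)
  then show ?case using num_semigroup_add[OF step.IH assms(1)] by (simp add: algebra_simps)
qed

lemma num_semigroup_subsetI:
  assumes "B \<subseteq> num_semigroup C"
  shows "num_semigroup B \<subseteq> num_semigroup C"
proof
  fix x assume "x \<in> num_semigroup B"
  then show "x \<in> num_semigroup C"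
    by induction (use assms in \<open>auto intro: num_semigroup.zero num_semigroup_add\<close>)
qed

lemma num_semigroup_dvd:
  assumes "x \<in> num_semigroup B" "\<And>b. b \<in> B \<Longrightarrow> n dvd b"
  shows "n dvd x"
  using assms(1) by induction (auto intro: assms(2) dvd_add)

section \<open>Division rounded up\<close>

definition ceil_div :: "int \<Rightarrow> int \<Rightarrow> int" where
  "ceil_div y k = - ((- y) div k)"

lemma ceil_div_ge: "0 < k \<Longrightarrow> y \<le> k * ceil_div y k"
  and ceil_div_less: "0 < k \<Longrightarrow> k * ceil_div y k < y + k"
proof -
  assume "0 < k"
  then have "- y = k * (- y div k) + (- y) mod k" "0 \<le> (- y) mod k" "(- y) mod k < k"
    by auto
  then show "y \<le> k * ceil_div y k" "k * ceil_div y k < y + k"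
    unfolding ceil_div_def mult_minus_right by linarith+
qed

lemma ceil_div_eqI:
  assumes "0 < k" "k * m < y + k" "y \<le> k * m"
  shows "ceil_div y k = m"
proof -
  have "k * ceil_div y k < k * (m + 1)" "k * m < k * (ceil_div y k + 1)"
    using ceil_div_ge[of k y] ceil_div_less[of k y] assms by (auto simp: algebra_simps)
  then show ?thesis using assms(1) by simp
qed

lemma ceil_div_0 [simp]: "ceil_div 0 k = 0"
  by (simp add: ceil_div_def)

lemma ceil_div_eq_1: "0 < y \<Longrightarrow> y \<le> k \<Longrightarrow> ceil_div y k = 1"
  by (rule ceil_div_eqI) auto

lemma ceil_div_mult_add: "0 < k \<Longrightarrow> ceil_div (k * m + y) k = m + ceil_div y k"
  using ceil_div_ge[of k y] ceil_div_less[of k y]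
  by (intro ceil_div_eqI) (auto simp: algebra_simps)

lemma ceil_div_mono: "0 < k \<Longrightarrow> x \<le> y \<Longrightarrow> ceil_div x k \<le> ceil_div y k"
  by (simp add: ceil_div_def zdiv_mono1)

lemma ceil_div_add_le: "0 < k \<Longrightarrow> ceil_div (x + y) k \<le> ceil_div x k + ceil_div y k"
proof -
  assume k: "0 < k"
  then have "k * ceil_div (x + y) k < k * (ceil_div x k + ceil_div y k + 1)"
    using ceil_div_ge[of k x] ceil_div_ge[of k y] ceil_div_less[of k "x + y"]
    by (simp add: algebra_simps)
  then show ?thesis using k by simp
qed

lemma ceil_div_Suc: "0 < k \<Longrightarrow> ceil_div (y + 1) k = ceil_div y k + (if k dvd y then 1 else 0)"
proof -
  assume k: "0 < k"
  show ?thesis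
  proof (cases "k dvd y")
    case True
    then obtain m where "y = k * m" by auto
    then show ?thesis using k ceil_div_mult_add[OF k, of m 0] ceil_div_mult_add[OF k, of m 1]
      by (simp add: ceil_div_eq_1)
  next
    case False
    then have "y \<noteq> k * ceil_div y k" by (metis dvd_triv_left)
    then have "ceil_div (y + 1) k = ceil_div y k"
      using k ceil_div_ge[of k y] ceil_div_less[of k y] by (intro ceil_div_eqI) auto
    then show ?thesis using False by simp
  qed
qed

text \<open>Write \<open>y = k * ceil_div y k - r\<close> with \<open>0 <= r < k\<close>. Then
  \<open>n - y = k * (m - ceil_div y k) + (r + 1)\<close> with \<open>1 <= r + 1 <= k\<close>, so
  rounding up adds exactly one to \<open>m - ceil_div y k\<close>.\<close>

lemma ceil_div_reflect:
  assumes "0 < k" "n = k * m + 1"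
  shows "ceil_div y k + ceil_div (n - y) k = ceil_div n k"
proof -
  have "ceil_div (n - y) k = m + 1 - ceil_div y k"
    using assms ceil_div_ge[of k y] ceil_div_less[of k y]
    by (intro ceil_div_eqI) (auto simp: algebra_simps)
  moreover have "ceil_div n k = m + 1"
    using assms by (intro ceil_div_eqI) (auto simp: algebra_simps)
  ultimately show ?thesis by simp
qed

text \<open>A converse of \<open>ceil_div_reflect\<close> from the single point 1:
  \<open>ceil_div\<close> must jump between \<open>n - 1\<close> and \<open>n\<close>, and it jumps
  only right after a multiple of \<open>k\<close>.\<close>

lemma ceil_div_reflect_one:
  assumes "2 \<le> k" "ceil_div 1 k + ceil_div (n - 1) k = ceil_div n k"
  obtains m where "n = k * m + 1"
proof -
  have "k dvd n - 1"
    using assms ceil_div_Suc[of k "n - 1"] ceil_div_eq_1[of 1 k] by (auto split: if_splits)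
  then show ?thesis using that by (auto simp: dvd_def algebra_simps)
qed

text \<open>Cramer's rule for a system with determinant \<open>a\<close>. It recovers
  \<open>d_eq\<close> and \<open>c_eq\<close> of the locale below from the relations in (c.2) and
  (d).\<close>

lemma lattice_coordinates:
  fixes a :: int
  assumes a: "a = s * P' - s' * P" and b: "d * s - c * P = a * \<delta>" "d * s' - c * P' = a * \<delta>'" and "0 < a"
  shows "d = P' * \<delta> - P * \<delta>'" "c = s' * \<delta> - s * \<delta>'"
proof -
  have "a * d = P' * (d * s - c * P) - P * (d * s' - c * P')" by (simp add: a algebra_simps)
  also have "\<dots> = a * (P' * \<delta> - P * \<delta>')" unfolding b by (simp add: algebra_simps)
  finally show "d = P' * \<delta> - P * \<delta>'" using \<open>0 < a\<close> by simp
  have "a * c = s' * (d * s - c * P) - s * (d * s' - c * P')" by (simp add: a algebra_simps)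
  also have "\<dots> = a * (s' * \<delta> - s * \<delta>')" unfolding b by (simp add: algebra_simps)
  finally show "c = s' * \<delta> - s * \<delta>'" using \<open>0 < a\<close> by simp
qed

section \<open>L-shaped description of the Apery set\<close>

text \<open>The vectors \<open>(s, -P)\<close> and \<open>(-s', P')\<close> form a basis of the lattice of all \<open>(y, z)\<close> with
  \<open>a dvd d * y + c * z\<close>. The numbers \<open>s + k * \<delta>\<close> and \<open>s' + k * \<delta>'\<close> are two consecutive terms
  \<open>R\<^sub>v > 0 \<ge> R\<^sub>v\<^sub>+\<^sub>1\<close> of Rodseth's sequence.\<close>

locale aa_lshape =
  fixes k s s' P P' \<delta> \<delta>' a d c :: int
  assumes k: "2 \<le> k"
    and s: "0 \<le> s'" "s' < s"
    and P: "0 \<le> P" "P < P'"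
    and a_eq: "a = s * P' - s' * P"
    and d_eq: "d = P' * \<delta> - P * \<delta>'"
    and c_eq: "c = s' * \<delta> - s * \<delta>'"
    and R_pos: "0 < s + k * \<delta>"
    and R_nonpos: "s' + k * \<delta>' \<le> 0"
    and d_pos: "0 < d" and c_pos: "0 < c"
    and cop: "coprime a d"
begin

abbreviation cl :: "int \<Rightarrow> int" where "cl y \<equiv> ceil_div y k"

abbreviation S :: "int set" where "S \<equiv> num_semigroup (aa_gens a d c k)"

text \<open>An \<open>s\<close> by \<open>P'\<close> rectangle without its upper right block of size
  \<open>s'\<close> by \<open>P\<close>. Its area is \<open>a\<close>, one point for each residue
  class modulo \<open>a\<close>.\<close>

definition L :: "(int \<times> int) set" where
  "L = {(y, z). 0 \<le> y \<and> y < s \<and> 0 \<le> z \<and> z < P' \<and> (y < s - s' \<or> z < P' - P)}"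

text \<open>A generator \<open>a + i * d\<close> supplies at most \<open>k\<close> copies of
  \<open>d\<close>, so \<open>cl y\<close> is the least number of them that supplies
  \<open>y\<close> copies.\<close>

definition \<omega> :: "int \<times> int \<Rightarrow> int" where
  "\<omega> q = a * cl (fst q) + d * fst q + c * snd q"

lemma k_pos: "0 < k"
  using k by simp

lemma a_pos: "0 < a"
proof -
  have "s' * P \<le> s' * P'" "s' * P' < s * P'"
    using s P by (auto intro: mult_left_mono)
  then show ?thesis by (simp add: a_eq)
qed

lemma basis1: "d * s - c * P = a * \<delta>"
  by (simp add: a_eq d_eq c_eq algebra_simps)

lemma basis2: "d * s' - c * P' = a * \<delta>'"
  by (simp add: a_eq d_eq c_eq algebra_simps)

section \<open>Elements of \<open>S\<close> as values of \<open>\<omega>\<close>\<close>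

lemma gen_mem: "0 \<le> i \<Longrightarrow> i \<le> k \<Longrightarrow> a + i * d \<in> S"
  by (rule num_semigroup_generator) auto

lemma c_mem: "c \<in> S"
  by (rule num_semigroup_generator) auto

lemma arithmetic_mem:
  assumes "0 \<le> m" "0 \<le> y" "y \<le> k * m"
  shows "a * m + d * y \<in> S"
  using assms
proof (induction m arbitrary: y rule: int_ge_induct)
  case base
  then show ?case by (simp add: num_semigroup.zero)
next
  case (step m)
  \<comment> \<open>Greedy choice: the largest step available, so that the rest fits into
    \<open>m\<close> generators.\<close>
  define i where "i = min k y"
  have "a * m + d * (y - i) \<in> S"
    using step by (intro step.IH) (auto simp: i_def min_def algebra_simps)
  moreover have "a + i * d \<in> S"
    using step k by (intro gen_mem) (auto simp: i_def)
  ultimately have "a * m + d * (y - i) + (a + i * d) \<in> S"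
    by (rule num_semigroup_add)
  moreover have "a * m + d * (y - i) + (a + i * d) = a * (m + 1) + d * y"
    by (simp add: algebra_simps)
  ultimately show ?case by simp
qed

text \<open>Here \<open>y\<close> is the sum of the indices \<open>i\<close> of the generators
  \<open>a + i * d\<close> used, \<open>z\<close> the number of copies of \<open>c\<close>, and
  \<open>t\<close> the number of such generators beyond the minimum \<open>cl y\<close>.\<close>

lemma mem_iff_omega:
  "x \<in> S \<longleftrightarrow> (\<exists>y z t. 0 \<le> y \<and> 0 \<le> z \<and> 0 \<le> t \<and> x = \<omega> (y, z) + a * t)"
proof
  assume "x \<in> S"
  then show "\<exists>y z t. 0 \<le> y \<and> 0 \<le> z \<and> 0 \<le> t \<and> x = \<omega> (y, z) + a * t"
  proof induction
    case zero
    show ?case by (rule exI[of _ 0])+ (simp add: \<omega>_def)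
  next
    case (add x b)
    then obtain y z t where yzt: "0 \<le> y" "0 \<le> z" "0 \<le> t" "x = \<omega> (y, z) + a * t" by blast
    from add.hyps(2) consider i where "b = a + i * d" "0 \<le> i" "i \<le> k" | "b = c" by blast
    then show ?case
    proof cases
      case 1
      \<comment> \<open>One generator more, less the growth of the minimum, which is at most one
        because \<open>i <= k\<close>.\<close>
      define t' where "t' = t + 1 + cl y - cl (y + i)"
      have "cl (y + i) \<le> cl y + 1"
        using ceil_div_add_le[OF k_pos, of y i] ceil_div_mono[OF k_pos 1(3)] ceil_div_eq_1[of k k] k
        by simp
      then have "0 \<le> t'" using yzt by (simp add: t'_def)
      moreover have "x + b = \<omega> (y + i, z) + a * t'"
        using yzt 1 by (simp add: \<omega>_def t'_def algebra_simps)
      ultimately show ?thesis using yzt(1,2) 1(2) by (metis add_nonneg_nonneg)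
    next
      case 2
      then have "x + b = \<omega> (y, z + 1) + a * t"
        using yzt by (simp add: \<omega>_def algebra_simps)
      then show ?thesis using yzt(1-3) by (metis add_nonneg_nonneg zero_le_one)
    qed
  qed
next
  assume "\<exists>y z t. 0 \<le> y \<and> 0 \<le> z \<and> 0 \<le> t \<and> x = \<omega> (y, z) + a * t"
  then obtain y z t where yzt: "0 \<le> y" "0 \<le> z" "0 \<le> t" "x = \<omega> (y, z) + a * t" by blast
  have cl: "0 \<le> cl y" using ceil_div_mono[OF k_pos yzt(1)] by simp
  have "y \<le> k * cl y" by (rule ceil_div_ge[OF k_pos])
  also have "\<dots> \<le> k * (cl y + t)" using yzt k by simp
  finally have "a * (cl y + t) + d * y \<in> S"
    using yzt(1,3) cl by (intro arithmetic_mem) auto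
  then have "a * (cl y + t) + d * y + z * c \<in> S"
    using num_semigroup_mult[OF c_mem yzt(2)] by (rule num_semigroup_add)
  then show "x \<in> S" using yzt(4) by (simp add: \<omega>_def algebra_simps)
qed

section \<open>Reduction to \<open>L\<close> and the Apery set\<close>

lemma omega_cong: "a dvd \<omega> (y, z) - (d * y + c * z)"
  by (simp add: \<omega>_def)

lemma omega_nonneg: "q \<in> L \<Longrightarrow> 0 \<le> \<omega> q"
  using ceil_div_mono[OF k_pos, of 0 "fst q"] a_pos d_pos c_pos by (auto simp: L_def \<omega>_def)

text \<open>The move changes \<open>\<omega>\<close> by
  \<open>a * (cl (y - s) - cl y - \<delta>)\<close>. By \<open>R_pos\<close>, \<open>k\<close> times
  the bracket is below \<open>k\<close>, so the integer in the bracket is at most 0.\<close>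

lemma reduce1: "\<omega> (y - s, z + P) \<le> \<omega> (y, z)"
proof -
  have "k * (cl (y - s) - cl y - \<delta>) < k * 1"
    using ceil_div_ge[OF k_pos, of y] ceil_div_less[OF k_pos, of "y - s"] R_pos
    by (simp add: algebra_simps)
  then have "cl (y - s) - cl y - \<delta> \<le> 0" using k_pos by (simp only: mult_less_cancel_left_pos)
  then have "a * (cl (y - s) - cl y - \<delta>) \<le> 0" using a_pos by (simp add: mult_le_0_iff)
  then show ?thesis using basis1 by (simp add: \<omega>_def algebra_simps)
qed

text \<open>As for \<open>reduce1\<close>; here \<open>R_nonpos\<close> suffices because
  \<open>ceil_div_less\<close> is already strict.\<close>

lemma reduce2: "\<omega> (y + s', z - P') \<le> \<omega> (y, z)"
proof -
  have "k * (cl (y + s') - cl y + \<delta>') < k * 1"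
    using ceil_div_ge[OF k_pos, of y] ceil_div_less[OF k_pos, of "y + s'"] R_nonpos
    by (simp add: algebra_simps)
  then have "cl (y + s') - cl y + \<delta>' \<le> 0" using k_pos by (simp only: mult_less_cancel_left_pos)
  then have "a * (cl (y + s') - cl y + \<delta>') \<le> 0" using a_pos by (simp add: mult_le_0_iff)
  then show ?thesis using basis2 by (simp add: \<omega>_def algebra_simps)
qed

lemma omega_mono: "y \<le> y' \<Longrightarrow> z \<le> z' \<Longrightarrow> \<omega> (y, z) \<le> \<omega> (y', z')"
  using ceil_div_mono[OF k_pos, of y y'] a_pos d_pos c_pos
  by (auto simp: \<omega>_def intro!: add_mono mult_left_mono)

text \<open>Each of the three reductions lowers the linear form \<open>(P + P') * y + (s + s') * z\<close> by at
  least \<open>a\<close>.\<close>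

lemma reduce_to_L:
  assumes "0 \<le> y" "0 \<le> z"
  shows "\<exists>y' z'. (y', z') \<in> L \<and> a dvd (d * y + c * z) - (d * y' + c * z') \<and> \<omega> (y', z') \<le> \<omega> (y, z)"
  using assms
proof (induction "nat ((P + P') * y + (s + s') * z)" arbitrary: y z rule: less_induct)
  case less
  have step: ?case
    if yz: "0 \<le> y1" "0 \<le> z1" and le: "\<omega> (y1, z1) \<le> \<omega> (y, z)"
      and m: "(P + P') * y1 + (s + s') * z1 < (P + P') * y + (s + s') * z"
      and cong: "a dvd (d * y + c * z) - (d * y1 + c * z1)" for y1 z1
  proof -
    have "0 \<le> (P + P') * y1 + (s + s') * z1" using yz s P by simp
    then have "nat ((P + P') * y1 + (s + s') * z1) < nat ((P + P') * y + (s + s') * z)"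
      using m by simp
    from less.hyps[OF this yz] obtain y' z' where "(y', z') \<in> L"
      "a dvd (d * y1 + c * z1) - (d * y' + c * z')" "\<omega> (y', z') \<le> \<omega> (y1, z1)" by blast
    moreover have "a dvd (d * y + c * z) - (d * y' + c * z')"
      using dvd_add[OF cong calculation(2)] by (simp add: algebra_simps)
    ultimately show ?thesis using le by (meson order_trans)
  qed
  consider "s \<le> y" | "P' \<le> z" | "s - s' \<le> y" "P' - P \<le> z" | "(y, z) \<in> L"
    using less.prems by (force simp: L_def)
  then show ?case
  proof cases
    case 1
    have "d * y + c * z - (d * (y - s) + c * (z + P)) = a * \<delta>"
      using basis1 by (simp add: algebra_simps)
    moreover have "(P + P') * (y - s) + (s + s') * (z + P) = (P + P') * y + (s + s') * z - a"
      by (simp add: a_eq algebra_simps)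
    ultimately show ?thesis using 1 less.prems P a_pos reduce1
      by (intro step[of "y - s" "z + P"]) auto
  next
    case 2
    have "d * y + c * z - (d * (y + s') + c * (z - P')) = a * (- \<delta>')"
      using basis2 by (simp add: algebra_simps)
    moreover have "(P + P') * (y + s') + (s + s') * (z - P') = (P + P') * y + (s + s') * z - a"
      by (simp add: a_eq algebra_simps)
    ultimately show ?thesis using 2 less.prems s a_pos reduce2
      by (intro step[of "y + s'" "z - P'"]) auto
  next
    \<comment> \<open>In the direction of the missing block the sum \<open>(s - s', P' - P)\<close>
      of both basis vectors is subtracted; it has no negative entry, so monotonicity of
      \<open>\<omega>\<close> is enough.\<close>
    case 3
    have "d * y + c * z - (d * (y - (s - s')) + c * (z - (P' - P))) = a * (\<delta> - \<delta>')"
      using basis1 basis2 by (simp add: algebra_simps)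
    moreover have "(P + P') * (y - (s - s')) + (s + s') * (z - (P' - P))
        = (P + P') * y + (s + s') * z - 2 * a"
      by (simp add: a_eq algebra_simps)
    ultimately show ?thesis using 3 less.prems s P a_pos
      by (intro step[of "y - (s - s')" "z - (P' - P)"]) (auto intro: omega_mono)
  next
    case 4
    show ?thesis by (rule exI[of _ y], rule exI[of _ z]) (use 4 in auto)
  qed
qed

text \<open>A positive coefficient makes the difference too long for \<open>L\<close>: at least
  \<open>s\<close> horizontally, at least \<open>P'\<close> vertically, or, for \<alpha> = \<beta>,
  so large in both directions that the first point falls into the missing block.\<close>

lemma L_unique_aux:
  assumes "(y1, z1) \<in> L" "(y2, z2) \<in> L"
    and y: "y1 - y2 = \<alpha> * s - \<beta> * s'" and z: "z1 - z2 = \<beta> * P' - \<alpha> * P"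
  shows "\<alpha> \<le> 0 \<and> \<beta> \<le> 0"
proof (rule ccontr)
  assume "\<not> (\<alpha> \<le> 0 \<and> \<beta> \<le> 0)"
  then consider "1 \<le> \<alpha>" "\<beta> \<le> 0" | "\<alpha> \<le> 0" "1 \<le> \<beta>" | "1 \<le> \<beta>" "\<beta> < \<alpha>"
    | "1 \<le> \<alpha>" "\<alpha> < \<beta>" | "1 \<le> \<alpha>" "\<alpha> = \<beta>" by linarith
  then show False
  proof cases
    case 1
    then have "1 * s \<le> \<alpha> * s" "\<beta> * s' \<le> 0" using s by (auto intro: mult_right_mono simp: mult_le_0_iff)
    then show ?thesis using y assms(1,2) by (auto simp: L_def)
  next
    case 2
    then have "1 * P' \<le> \<beta> * P'" "\<alpha> * P \<le> 0" using P by (auto intro: mult_right_mono simp: mult_le_0_iff)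
    then show ?thesis using z assms(1,2) by (auto simp: L_def)
  next
    case 3
    then have "1 * s \<le> (\<alpha> - \<beta>) * s" "0 \<le> \<beta> * (s - s')" using s by (auto intro: mult_right_mono)
    then show ?thesis using y assms(1,2) by (auto simp: L_def algebra_simps)
  next
    case 4
    then have "1 * P' \<le> (\<beta> - \<alpha>) * P'" "0 \<le> \<alpha> * (P' - P)" using P by (auto intro: mult_right_mono)
    then show ?thesis using z assms(1,2) by (auto simp: L_def algebra_simps)
  next
    case 5
    then have "1 * (s - s') \<le> \<alpha> * (s - s')" "1 * (P' - P) \<le> \<alpha> * (P' - P)"
      using s P by (auto intro: mult_right_mono)
    then show ?thesis using y z 5 assms(1,2) by (auto simp: L_def algebra_simps)
  qed
qed

lemma L_unique:
  assumes "(y1, z1) \<in> L" "(y2, z2) \<in> L" "a dvd (d * y1 + c * z1) - (d * y2 + c * z2)"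
  shows "(y1, z1) = (y2, z2)"
proof -
  define Y Z where "Y = y1 - y2" and "Z = z1 - z2"
  have *: "a dvd d * Y + c * Z"
    using assms(3) by (simp add: Y_def Z_def algebra_simps)
  \<comment> \<open>The lattice coordinates \<alpha> and \<beta> of \<open>(Y, Z)\<close> are found
    by Cramer's rule; the divisibility by \<open>a\<close> comes with a factor \<open>d\<close>,
    which coprimality removes.\<close>
  have "d * (P' * Y + s' * Z) = P' * (d * Y + c * Z) + a * (\<delta>' * Z)"
    using arg_cong[OF basis2, of "\<lambda>t. t * Z"] by (simp add: algebra_simps)
  then have "a dvd d * (P' * Y + s' * Z)" using * by simp
  then have "a dvd P' * Y + s' * Z" using cop by (simp add: coprime_dvd_mult_right_iff)
  then obtain \<alpha> where \<alpha>: "P' * Y + s' * Z = a * \<alpha>" by blast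
  have "d * (P * Y + s * Z) = P * (d * Y + c * Z) + a * (\<delta> * Z)"
    using arg_cong[OF basis1, of "\<lambda>t. t * Z"] by (simp add: algebra_simps)
  then have "a dvd d * (P * Y + s * Z)" using * by simp
  then have "a dvd P * Y + s * Z" using cop by (simp add: coprime_dvd_mult_right_iff)
  then obtain \<beta> where \<beta>: "P * Y + s * Z = a * \<beta>" by blast
  have "a * Y = s * (P' * Y + s' * Z) - s' * (P * Y + s * Z)"
    by (simp add: a_eq algebra_simps)
  also have "\<dots> = a * (\<alpha> * s - \<beta> * s')" unfolding \<alpha> \<beta> by (simp add: algebra_simps)
  finally have Y: "Y = \<alpha> * s - \<beta> * s'" using a_pos by simp
  have "a * Z = P' * (P * Y + s * Z) - P * (P' * Y + s' * Z)"
    by (simp add: a_eq algebra_simps)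
  also have "\<dots> = a * (\<beta> * P' - \<alpha> * P)" unfolding \<alpha> \<beta> by (simp add: algebra_simps)
  finally have Z: "Z = \<beta> * P' - \<alpha> * P" using a_pos by simp
  have "\<alpha> \<le> 0 \<and> \<beta> \<le> 0"
    using Y Z by (intro L_unique_aux[OF assms(1,2)]) (auto simp: Y_def Z_def)
  moreover have "- \<alpha> \<le> 0 \<and> - \<beta> \<le> 0"
    using Y Z by (intro L_unique_aux[OF assms(2,1)]) (auto simp: Y_def Z_def)
  ultimately have "\<alpha> = 0" "\<beta> = 0" by auto
  then show ?thesis using Y Z by (simp add: Y_def Z_def)
qed

lemma L_cover: "\<exists>q\<in>L. a dvd x - \<omega> q"
proof -
  obtain u v where uv: "u * a + v * d = 1"
    using cop bezout_int[of a d] by auto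
  \<comment> \<open>Since \<open>v\<close> inverts \<open>d\<close> modulo \<open>a\<close>, the
    point \<open>(y, 0)\<close> represents the class of \<open>x\<close>.\<close>
  define y where "y = (v * x) mod a"
  have "a dvd v * x - y"
    by (simp add: y_def minus_mod_eq_mult_div)
  then have "a dvd d * (v * x - y)" by simp
  moreover have "x - d * y = d * (v * x - y) + a * (u * x)"
    using arg_cong[OF uv, of "\<lambda>t. t * x"] by (simp add: algebra_simps)
  ultimately have "a dvd x - d * y" by simp
  moreover have "0 \<le> y" using a_pos by (simp add: y_def)
  then obtain y' z' where "(y', z') \<in> L" and "a dvd (d * y + c * 0) - (d * y' + c * z')"
    using reduce_to_L[of y 0] by auto
  moreover have "a dvd (d * y' + c * z') - \<omega> (y', z')"
    using omega_cong[of y' z'] by (simp add: dvd_diff_commute)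
  ultimately have "a dvd (x - d * y) + ((d * y + c * 0) - (d * y' + c * z'))
      + ((d * y' + c * z') - \<omega> (y', z'))"
    by (metis dvd_add)
  then show ?thesis using \<open>(y', z') \<in> L\<close> by (intro bexI[of _ "(y', z')"]) auto
qed

lemma omega_inj:
  assumes "p \<in> L" "q \<in> L" "a dvd \<omega> p - \<omega> q"
  shows "p = q"
proof -
  obtain y1 z1 y2 z2 where pq: "p = (y1, z1)" "q = (y2, z2)" by fastforce
  have "a dvd (\<omega> p - \<omega> q) - (\<omega> (y1, z1) - (d * y1 + c * z1)) + (\<omega> (y2, z2) - (d * y2 + c * z2))"
    by (rule dvd_add[OF dvd_diff[OF assms(3) omega_cong] omega_cong])
  then have "a dvd (d * y1 + c * z1) - (d * y2 + c * z2)"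
    by (simp add: pq algebra_simps)
  then show ?thesis using L_unique[of y1 z1 y2 z2] assms pq by simp
qed

text \<open>So \<open>\<omega> q\<close> is the Apery element of its class: each element of
  \<open>S\<close> in the class reduces to a point of \<open>L\<close> with no larger
  \<open>\<omega>\<close>, and by injectivity this point is \<open>q\<close>.\<close>

lemma mem_iff_ge:
  assumes "q \<in> L" "a dvd x - \<omega> q"
  shows "x \<in> S \<longleftrightarrow> \<omega> q \<le> x"
proof
  assume "x \<in> S"
  then obtain y z t where yzt: "0 \<le> y" "0 \<le> z" "0 \<le> t" "x = \<omega> (y, z) + a * t"
    using mem_iff_omega by blast
  obtain y' z' where y'z': "(y', z') \<in> L" "a dvd (d * y + c * z) - (d * y' + c * z')"
      "\<omega> (y', z') \<le> \<omega> (y, z)"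
    using reduce_to_L[OF yzt(1,2)] by blast
  have "a dvd ((d * y + c * z) - (d * y' + c * z')) + (\<omega> (y, z) - (d * y + c * z))
      - (\<omega> (y', z') - (d * y' + c * z'))"
    by (rule dvd_diff[OF dvd_add[OF y'z'(2) omega_cong] omega_cong])
  then have "a dvd \<omega> (y, z) - \<omega> (y', z')" by simp
  then have "a dvd (\<omega> (y, z) - \<omega> (y', z')) + a * t - (x - \<omega> q)"
    by (rule dvd_diff[OF dvd_add[OF _ dvd_triv_left] assms(2)])
  then have "a dvd \<omega> q - \<omega> (y', z')" using yzt(4) by simp
  then have "q = (y', z')" using omega_inj assms(1) y'z'(1) by blast
  moreover have "0 \<le> a * t" using a_pos yzt(3) by simp
  ultimately show "\<omega> q \<le> x" using y'z'(3) yzt(4) by simp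
next
  assume le: "\<omega> q \<le> x"
  obtain t where t: "x - \<omega> q = a * t" using assms(2) by blast
  have "0 \<le> t" using t le a_pos by (metis diff_ge_0_iff_ge zero_le_mult_iff not_le)
  show "x \<in> S" unfolding mem_iff_omega
    by (rule exI[of _ "fst q"], rule exI[of _ "snd q"], rule exI[of _ t])
      (use assms(1) t \<open>0 \<le> t\<close> in \<open>auto simp: L_def\<close>)
qed

section \<open>Corners, Frobenius number and a criterion for pseudo-symmetry\<close>

lemma corner1_mem: "(s - s' - 1, P' - 1) \<in> L"
  and corner2_mem: "(s - 1, P' - P - 1) \<in> L"
  using s P by (auto simp: L_def)

lemma omega_le_corner:
  assumes "q \<in> L"
  shows "\<omega> q \<le> max (\<omega> (s - s' - 1, P' - 1)) (\<omega> (s - 1, P' - P - 1))"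
proof -
  obtain y z where q: "q = (y, z)" by fastforce
  then consider "y \<le> s - s' - 1" "z \<le> P' - 1" | "y \<le> s - 1" "z \<le> P' - P - 1"
    using assms by (auto simp: L_def)
  then show ?thesis
    unfolding q by cases (blast intro: max.coboundedI1 max.coboundedI2 omega_mono)+
qed

text \<open>The Brauer-Shockley formula: the last gap in each class lies \<open>a\<close> below the
  Apery element.\<close>

lemma frobenius_eq:
  assumes "p \<in> L" and max: "\<And>q. q \<in> L \<Longrightarrow> \<omega> q \<le> \<omega> p"
  shows "frobenius S = \<omega> p - a"
  unfolding frobenius_def
proof (rule Greatest_equality)
  show "\<omega> p - a \<notin> S" using mem_iff_ge[OF assms(1), of "\<omega> p - a"] a_pos by simp
next
  fix x assume x: "x \<notin> S"
  obtain q t where q: "q \<in> L" "x - \<omega> q = a * t" using L_cover[of x] by blast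
  then have "a * t < 0" using x mem_iff_ge[of q x] by auto
  then have "a * (t + 1) \<le> 0" using a_pos by (simp add: mult_less_0_iff mult_le_0_iff)
  then show "x \<le> \<omega> p - a" using q max[OF q(1)] by (simp add: algebra_simps)
qed

lemma omega_add_mult_mem_iff:
  assumes "q \<in> L"
  shows "\<omega> q + a * t \<in> S \<longleftrightarrow> 0 \<le> t"
  using mem_iff_ge[OF assms, of "\<omega> q + a * t"] a_pos by (simp add: zero_le_mult_iff)

text \<open>The class of \<open>q\<close> modulo \<open>a\<close> contains exactly \<open>D q\<close> integers \<open>x\<close> such that neither
  \<open>x\<close> nor its mirror image \<open>F - x\<close> lies in \<open>S\<close>.\<close>

lemma pseudo_symmetric_iff:
  assumes p: "p \<in> L" and max: "\<And>q. q \<in> L \<Longrightarrow> \<omega> q \<le> \<omega> p"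
    and \<sigma>: "\<And>q. q \<in> L \<Longrightarrow> \<sigma> q \<in> L"
    and D: "\<And>q. q \<in> L \<Longrightarrow> \<omega> q + \<omega> (\<sigma> q) = \<omega> p + a * D q"
  shows "pseudo_symmetric S \<longleftrightarrow> (\<exists>q0\<in>L. D q0 = 1 \<and> (\<forall>q\<in>L. q \<noteq> q0 \<longrightarrow> D q = 0))"
proof -
  define g where "g = \<omega> p - a"
  have g: "frobenius S = g" unfolding g_def by (rule frobenius_eq[OF p max])
  have mirror: "x \<in> {g - y | y. y \<in> S} \<longleftrightarrow> g - x \<in> S" for x
  proof
    assume "x \<in> {g - y | y. y \<in> S}"
    then obtain y where "x = g - y" "y \<in> S" by blast
    then show "g - x \<in> S" by simp
  next
    assume "g - x \<in> S"
    moreover have "x = g - (g - x)" by simp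
    ultimately show "x \<in> {g - y | y. y \<in> S}" by blast
  qed
  define T where "T = S \<union> {g - x | x. x \<in> S}"
  have T_iff: "x \<in> T \<longleftrightarrow> x \<in> S \<or> g - x \<in> S" for x
    unfolding T_def using mirror[of x] by blast
  have gap: "\<omega> q + a * t \<in> T \<longleftrightarrow> 0 \<le> t \<or> t \<le> - 1 - D q"
    if q: "q \<in> L" for q t
  proof -
    have eq: "g - (\<omega> q + a * t) = \<omega> (\<sigma> q) + a * (- 1 - D q - t)"
      using D[OF q] by (simp add: g_def algebra_simps)
    show ?thesis
      unfolding T_iff eq omega_add_mult_mem_iff[OF \<sigma>[OF q]] omega_add_mult_mem_iff[OF q] by linarith
  qed
  \<comment> \<open>The sum of the two values lies in \<open>S\<close> and in the class of
    \<open>p\<close>, where \<open>\<omega> p\<close> is the least element.\<close>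
  have D_nonneg: "0 \<le> D q" if q: "q \<in> L" for q
  proof -
    have "\<omega> q \<in> S" "\<omega> (\<sigma> q) \<in> S"
      using omega_add_mult_mem_iff[OF q, of 0] omega_add_mult_mem_iff[OF \<sigma>[OF q], of 0] by auto
    then have "\<omega> p + a * D q \<in> S" unfolding D[OF q, symmetric] by (rule num_semigroup_add)
    then show ?thesis using omega_add_mult_mem_iff[OF p] by simp
  qed
  have cover: "\<exists>q\<in>L. \<exists>t. x = \<omega> q + a * t" for x
  proof -
    obtain q t where "q \<in> L" "x - \<omega> q = a * t" using L_cover[of x] by blast
    then have "x = \<omega> q + a * t" by simp
    then show ?thesis using \<open>q \<in> L\<close> by blast
  qed
  have ps_iff: "pseudo_symmetric S \<longleftrightarrow> even g \<and> T = UNIV - {g div 2}"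
    unfolding pseudo_symmetric_def g T_def Let_def by (rule refl)
  show ?thesis
  proof
    assume "pseudo_symmetric S"
    then have ps: "T = UNIV - {g div 2}"
      using ps_iff by blast
    then have gap': "\<omega> q + a * t = g div 2 \<longleftrightarrow> - D q \<le> t \<and> t \<le> - 1" if "q \<in> L" for q t
      using gap[OF that, of t, unfolded ps] by auto
    obtain q0 t0 where q0: "q0 \<in> L" "g div 2 = \<omega> q0 + a * t0" using cover by blast
    have eq: "q = q0 \<and> D q = 1" if "q \<in> L" "D q \<noteq> 0" for q
    proof -
      have "1 \<le> D q" using D_nonneg[OF that(1)] that(2) by simp
      \<comment> \<open>Both ends of the gap of \<open>q\<close> are the one missing integer, so the
        gap has length one.\<close>
      then have *: "\<omega> q + a * (- 1) = g div 2" "\<omega> q + a * (- D q) = g div 2"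
        using gap'[OF that(1), of "- 1"] gap'[OF that(1), of "- D q"] by simp_all
      then have "a * D q = a" by linarith
      then have "D q = 1" using a_pos by simp
      have "\<omega> q - \<omega> q0 = a * (t0 + 1)" using *(1) q0(2) by (simp add: algebra_simps)
      then have "q = q0" using omega_inj[OF that(1) q0(1)] by simp
      then show ?thesis using \<open>D q = 1\<close> by simp
    qed
    have "D q0 \<noteq> 0" using gap'[OF q0(1), of t0] q0(2) by auto
    then show "\<exists>q0\<in>L. D q0 = 1 \<and> (\<forall>q\<in>L. q \<noteq> q0 \<longrightarrow> D q = 0)"
      using eq q0(1) by blast
  next
    assume "\<exists>q0\<in>L. D q0 = 1 \<and> (\<forall>q\<in>L. q \<noteq> q0 \<longrightarrow> D q = 0)"
    then obtain q0 where q0: "q0 \<in> L" "D q0 = 1" "\<And>q. q \<in> L \<Longrightarrow> q \<noteq> q0 \<Longrightarrow> D q = 0" by blast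
    define x0 where "x0 = \<omega> q0 - a"
    have compl: "x \<in> T \<longleftrightarrow> x \<noteq> x0" for x
    proof -
      obtain q t where q: "q \<in> L" "x = \<omega> q + a * t" using cover by blast
      show ?thesis
      proof (cases "q = q0")
        case True
        have "x = x0 \<longleftrightarrow> a * t = a * (- 1)" using True q(2) by (auto simp: x0_def)
        also have "\<dots> \<longleftrightarrow> t = - 1" using a_pos by (subst mult_left_cancel) auto
        finally show ?thesis using gap[OF q0(1), of t] True q q0(2) by auto
      next
        case False
        have "x \<noteq> x0"
        proof
          assume "x = x0"
          then have "\<omega> q - \<omega> q0 = a * (- 1 - t)" using q(2) by (simp add: x0_def algebra_simps)
          then show False using omega_inj[OF q(1) q0(1)] False by simp
        qed
        then show ?thesis using gap[OF q(1), of t] q q0(3)[OF q(1) False] by auto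
      qed
    qed
    \<comment> \<open>The only integer outside the symmetric set \<open>T\<close> is its own mirror
      image; this yields the parity of \<open>g\<close>.\<close>
    have sym: "x \<in> T \<longleftrightarrow> g - x \<in> T" for x
      unfolding T_iff by auto
    have "g - x0 = x0" using compl[of "g - x0"] compl[of x0] sym[of x0] by blast
    then have "g = 2 * x0" by simp
    then have "even g" "g div 2 = x0" by simp_all
    moreover have "T = UNIV - {x0}" using compl by blast
    ultimately show "pseudo_symmetric S" using ps_iff by blast
  qed
qed

text \<open>Maximality of \<open>\<omega> p\<close> follows from the sums: for \<open>q\<close>
  other than \<open>q0\<close> the mirror value is nonnegative, and at \<open>q0\<close> the sum
  gives \<open>2 * \<omega> q0 = \<omega> p + a <= 2 * \<omega> p\<close>. The last bound
  \<open>a <= \<omega> p\<close> comes from \<open>1 <= fst p\<close>.\<close>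

lemma pseudo_symmetricI:
  assumes p: "p \<in> L" and p_pos: "1 \<le> fst p"
    and \<sigma>: "\<And>q. q \<in> L \<Longrightarrow> \<sigma> q \<in> L"
    and D: "\<And>q. q \<in> L \<Longrightarrow> \<omega> q + \<omega> (\<sigma> q) = \<omega> p + a * D q"
    and q0: "q0 \<in> L" "\<sigma> q0 = q0" "D q0 = 1"
    and others: "\<And>q. q \<in> L \<Longrightarrow> q \<noteq> q0 \<Longrightarrow> D q = 0"
  shows "pseudo_symmetric S"
proof -
  have "1 \<le> cl (fst p)"
    using ceil_div_mono[OF k_pos p_pos] ceil_div_eq_1[of 1 k] k by simp
  then have "a * 1 \<le> a * cl (fst p)" using a_pos by (intro mult_left_mono) auto
  moreover have "0 \<le> d * fst p" "0 \<le> c * snd p" using p d_pos c_pos by (auto simp: L_def)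
  ultimately have a_le: "a \<le> \<omega> p" by (simp add: \<omega>_def)
  have "\<omega> q \<le> \<omega> p" if q: "q \<in> L" for q
  proof (cases "q = q0")
    case True
    then show ?thesis using D[OF q0(1)] q0(2,3) a_le by simp
  next
    case False
    then show ?thesis using D[OF q] others[OF q] omega_nonneg[OF \<sigma>[OF q]] by simp
  qed
  then show ?thesis using pseudo_symmetric_iff[OF p _ \<sigma> D] q0 others by blast
qed

text \<open>On the rectangle containing the corner the reflection is \<open>q \<mapsto> corner - q\<close>; on the other one
  it is corrected by the basis vector \<open>(s, -P)\<close>, for the second corner by \<open>(-s', P')\<close>.\<close>

definition refl1 :: "int \<times> int \<Rightarrow> int \<times> int" where
  "refl1 q = (if fst q \<le> s - s' - 1 then (s - s' - 1 - fst q, P' - 1 - snd q)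
     else (2 * s - s' - 1 - fst q, P' - P - 1 - snd q))"

text \<open>The excess of the mirror sum over the corner value, in units of \<open>a\<close>. The
  linear parts cancel up to the \<open>a * \<delta>\<close> of the correcting basis vector, so only
  the first coordinate matters.\<close>

definition defect1 :: "int \<Rightarrow> int" where
  "defect1 y = (if y \<le> s - s' - 1 then cl y + cl (s - s' - 1 - y) - cl (s - s' - 1)
     else cl y + cl (2 * s - s' - 1 - y) - cl (s - s' - 1) + \<delta>)"

lemma refl1_mem: "q \<in> L \<Longrightarrow> refl1 q \<in> L"
  using s P by (auto simp: L_def refl1_def split: if_splits)

lemma omega_refl1:
  "\<omega> q + \<omega> (refl1 q) = \<omega> (s - s' - 1, P' - 1) + a * defect1 (fst q)"
  using basis1 by (auto simp: \<omega>_def refl1_def defect1_def algebra_simps)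

definition refl2 :: "int \<times> int \<Rightarrow> int \<times> int" where
  "refl2 q = (if snd q < P' - P then (s - 1 - fst q, P' - P - 1 - snd q)
     else (s - s' - 1 - fst q, 2 * P' - P - 1 - snd q))"

definition defect2 :: "int \<times> int \<Rightarrow> int" where
  "defect2 q = (if snd q < P' - P then cl (fst q) + cl (s - 1 - fst q) - cl (s - 1)
     else cl (fst q) + cl (s - s' - 1 - fst q) - cl (s - 1) - \<delta>')"

lemma refl2_mem: "q \<in> L \<Longrightarrow> refl2 q \<in> L"
  using s P by (auto simp: L_def refl2_def split: if_splits)

lemma omega_refl2:
  "\<omega> q + \<omega> (refl2 q) = \<omega> (s - 1, P' - P - 1) + a * defect2 q"
  using basis2 by (auto simp: \<omega>_def refl2_def defect2_def algebra_simps)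

section \<open>Shapes forced by pseudo-symmetry\<close>

lemma defect1_cases:
  assumes P1: "1 \<le> P" and q0: "q0 \<in> L" "defect1 (fst q0) = 1"
    and "\<forall>q\<in>L. q \<noteq> q0 \<longrightarrow> defect1 (fst q) = 0"
  obtains m where "0 \<le> m" "P' = P + 1" "s' = 1" "s = k * m + 3" "\<delta> = - m"
  | m where "0 \<le> m" "P' = P + 1" "s' = 2 * k - 1" "s = k * m + 2 * k + 1" "\<delta> = - (m + 2)"
proof -
  have others: "defect1 (fst q) = 0" if "q \<in> L" "q \<noteq> q0" for q
    using assms(4) that by blast
  define e where "e = s - s' - 1"
  have e: "0 \<le> e" using s by (simp add: e_def)
  obtain y0 z0 where yz: "q0 = (y0, z0)" by fastforce
  \<comment> \<open>The defect ignores \<open>z\<close>, so the column of \<open>L\<close> above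
    \<open>y0\<close> is a single point. Columns up to \<open>e\<close> have height
    \<open>P' >= 2\<close>, the others \<open>P' - P\<close>.\<close>
  have uniq: "z = z0" if "(y0, z) \<in> L" for z
    using others[OF that] q0(2) yz by auto
  have y0: "0 \<le> y0" "y0 < s" using q0(1) yz by (auto simp: L_def)
  have "e < y0"
  proof (rule ccontr)
    assume "\<not> e < y0"
    then have "(y0, 0) \<in> L" "(y0, P' - 1) \<in> L"
      using y0 P by (auto simp: L_def e_def)
    then show False using uniq[of 0] uniq[of "P' - 1"] P P1 by simp
  qed
  then have "(y0, 0) \<in> L" "(y0, P' - P - 1) \<in> L"
    using y0 P by (auto simp: L_def e_def)
  then have P'_eq: "P' = P + 1" using uniq[of 0] uniq[of "P' - P - 1"] by simp
  have D0: "defect1 y = 0" if "0 \<le> y" "y < s" "y \<noteq> y0" for y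
    using others[of "(y, 0)"] that P yz by (auto simp: L_def)
  have D1: "defect1 y0 = 1" using q0(2) yz by simp
  have high: "defect1 y = cl y + cl (2 * e + 1 + s' - y) - cl e + \<delta>" if "e < y" for y
    using that by (simp add: defect1_def e_def algebra_simps)
  \<comment> \<open>The formula \<open>high\<close> is invariant under the reflection of the outer
    columns, hence the only exceptional column is fixed by it.\<close>
  have y0_mid: "2 * y0 = 2 * e + 1 + s'"
  proof -
    have "defect1 (2 * e + 1 + s' - y0) = defect1 y0"
      using y0 \<open>e < y0\<close> high[of y0] high[of "2 * e + 1 + s' - y0"] by (simp add: e_def)
    moreover have "0 \<le> 2 * e + 1 + s' - y0" "2 * e + 1 + s' - y0 < s"
      using y0 s \<open>e < y0\<close> by (auto simp: e_def)
    ultimately have "2 * e + 1 + s' - y0 = y0"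
      using D0[of "2 * e + 1 + s' - y0"] D1 by fastforce
    then show ?thesis by simp
  qed
  \<comment> \<open>For \<open>e > 0\<close> column 1 is an inner column and therefore
    regular.\<close>
  have e_cases: "e = 0 \<or> (\<exists>m. e = k * m + 1)"
  proof (cases "e = 0")
    case False
    then have "defect1 1 = 0" using e s \<open>e < y0\<close> y0 by (intro D0) (auto simp: e_def)
    then have "cl 1 + cl (e - 1) = cl e" using False e by (simp add: defect1_def e_def)
    then show ?thesis using ceil_div_reflect_one[OF k] by blast
  qed simp
  have s'_pos: "0 < s'" using \<open>e < y0\<close> y0 by (simp add: e_def)
  show ?thesis
  proof (cases "s' = 1")
    case True
    then have "y0 = e + 1" using y0_mid by simp
    then have eq: "2 * cl (e + 1) - cl e + \<delta> = 1" using D1 high[of y0] True by simp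
    have "e \<noteq> 0"
    proof
      assume "e = 0"
      then have "\<delta> = - 1" "s = 2" using eq k True ceil_div_eq_1[of 1 k] by (auto simp: e_def)
      then show False using R_pos k by simp
    qed
    then obtain m where m: "e = k * m + 1" using e_cases by blast
    have "cl e = m + 1" "cl (e + 1) = m + 1"
      using m k ceil_div_mult_add[OF k_pos, of m 1] ceil_div_mult_add[OF k_pos, of m 2]
      by (auto simp: ceil_div_eq_1 algebra_simps)
    then have "\<delta> = - m" using eq by simp
    moreover have "0 \<le> k * m" using e m \<open>e \<noteq> 0\<close> by linarith
    then have "0 \<le> m" using k by (simp add: zero_le_mult_iff)
    moreover have "s = k * m + 3" using m True by (simp add: e_def)
    ultimately show ?thesis using that(1) P'_eq True by blast
  next
    case False
    have s'3: "3 \<le> s'" using False s'_pos y0_mid by presburger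
    have y0_low: "e + 2 \<le> y0" using y0_mid s'3 by simp
    \<comment> \<open>The defect drops by one next to the centre, so \<open>cl\<close> jumps from
      \<open>y0 - 1\<close> to \<open>y0\<close> and not from \<open>y0\<close> to
      \<open>y0 + 1\<close>.\<close>
    have "defect1 (y0 - 1) = 0" using y0_low y0 e by (intro D0) auto
    moreover have "2 * e + 1 + s' - (y0 - 1) = y0 + 1" using y0_mid by simp
    ultimately have "cl (y0 - 1) + cl (y0 + 1) - cl e + \<delta> = 0"
      using high[of "y0 - 1"] y0_low by simp
    moreover have "2 * cl y0 - cl e + \<delta> = 1"
    proof -
      have mid: "2 * e + 1 + s' - y0 = y0" using y0_mid by simp
      have "cl y0 + cl (2 * e + 1 + s' - y0) - cl e + \<delta> = 1"
        using high[of y0] y0_low D1 by simp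
      then show ?thesis unfolding mid by simp
    qed
    ultimately have "k dvd y0 - 1"
      using ceil_div_Suc[OF k_pos, of y0] ceil_div_Suc[OF k_pos, of "y0 - 1"]
      by (auto split: if_splits)
    then obtain j where j: "y0 = k * j + 1" by (auto simp: dvd_def algebra_simps)
    \<comment> \<open>A shift by \<open>k\<close> within the outer columns would produce a second
      exceptional point.\<close>
    have "y0 - k \<le> e"
    proof (rule ccontr)
      assume *: "\<not> y0 - k \<le> e"
      have "cl (y0 - k) = cl y0 - 1" "cl (y0 + k) = cl y0 + 1"
        using ceil_div_mult_add[OF k_pos, of 1 y0] ceil_div_mult_add[OF k_pos, of "- 1" y0]
        by (simp_all add: algebra_simps)
      moreover have mid: "2 * e + 1 + s' - (y0 - k) = y0 + k" "2 * e + 1 + s' - y0 = y0"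
        using y0_mid by simp_all
      ultimately have "defect1 (y0 - k) = defect1 y0"
        using high[of "y0 - k", unfolded mid] high[of y0, unfolded mid] * \<open>e < y0\<close> by simp
      then show False using D0[of "y0 - k"] D1 * e y0 k by simp
    qed
    have "e \<noteq> 0"
    proof
      assume "e = 0"
      then have "k * 0 < k * j" "k * j < k * 1" using j y0_low \<open>y0 - k \<le> e\<close> by linarith+
      then have "0 < j" "j < 1" using k_pos by (simp_all only: mult_less_cancel_left_pos)
      then show False by simp
    qed
    then obtain m where m: "e = k * m + 1" using e_cases by blast
    \<comment> \<open>Both \<open>e\<close> and \<open>y0\<close> are 1 modulo \<open>k\<close>, and
      their distance is positive and at most \<open>k\<close>, hence equal to
      \<open>k\<close>.\<close>
    have "k * (m + 2) = k * m + 2 * k" by (simp add: algebra_simps)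
    then have "k * m < k * j" "k * j < k * (m + 2)"
      using j m y0_low \<open>y0 - k \<le> e\<close> k by linarith+
    then have "m < j" "j < m + 2" using k_pos by (simp_all only: mult_less_cancel_left_pos)
    then have "j = m + 1" by simp
    then have y0_eq: "y0 = e + k" using j m by (simp add: algebra_simps)
    then have s'_eq: "s' = 2 * k - 1" using y0_mid by simp
    have "cl e = m + 1" "cl (e + k) = m + 2"
      using m k ceil_div_mult_add[OF k_pos, of m 1] ceil_div_mult_add[OF k_pos, of "m + 1" 1]
      by (auto simp: ceil_div_eq_1 algebra_simps)
    then have "\<delta> = - (m + 2)" using D1 high[of y0] \<open>e < y0\<close> y0_eq s'_eq by simp
    moreover have "0 \<le> k * m" using e m \<open>e \<noteq> 0\<close> by linarith
    then have "0 \<le> m" using k by (simp add: zero_le_mult_iff)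
    moreover have "s = k * m + 2 * k + 1" using m s'_eq by (simp add: e_def)
    ultimately show ?thesis using that(2) P'_eq s'_eq by blast
  qed
qed

text \<open>The exceptional point lies either in the bottom rectangle, then a row of three points
  with nothing or a single column above it, or in the upper rectangle, then a row of one or three
  points.\<close>

lemma defect2_cases:
  assumes nontriv: "P = 0 \<or> 2 \<le> s" and q0: "q0 \<in> L" "defect2 q0 = 1"
    and "\<forall>q\<in>L. q \<noteq> q0 \<longrightarrow> defect2 q = 0"
  obtains "P = 0" "P' = 1" "s = 3"
  | "1 \<le> P" "P' = P + 1" "s = 3" "s' = 2" "\<delta>' = - 1"
  | m where "0 \<le> m" "P = 1" "s = k * m + 2" "s' = s - 1" "\<delta>' = - (m + 2)"
  | m where "1 \<le> m" "P = 1" "s = k * m + 2" "s' = s - 3" "\<delta>' = - m"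
proof -
  have others: "defect2 q = 0" if "q \<in> L" "q \<noteq> q0" for q
    using assms(4) that by blast
  define f where "f = s - s' - 1"
  have f: "0 \<le> f" using s by (simp add: f_def)
  obtain y0 z0 where yz: "q0 = (y0, z0)" by fastforce
  have uniq: "q = q0" if "q \<in> L" "defect2 q = 1" for q
    using others[of q] that by auto
  have y0: "0 \<le> y0" "y0 < s" using q0(1) yz by (auto simp: L_def)
  have low: "defect2 (y, z) = cl y + cl (s - 1 - y) - cl (s - 1)" if "z < P' - P" for y z
    using that by (simp add: defect2_def)
  have high: "defect2 (y, z) = cl y + cl (f - y) - cl (s - 1) - \<delta>'" if "P' - P \<le> z" for y z
    using that by (simp add: defect2_def f_def)
  show ?thesis
  proof (cases "z0 < P' - P")
    case True
    have mem: "(y, z) \<in> L" if "0 \<le> y" "y < s" "0 \<le> z" "z < P' - P" for y z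
      using that P by (auto simp: L_def)
    have D_y0: "defect2 (y0, z) = 1" if "z < P' - P" for z
      using low[OF that] low[OF True] q0(2) yz by simp
    have "0 = z0" "P' - P - 1 = z0"
      using uniq[OF mem D_y0, of 0] uniq[OF mem D_y0, of "P' - P - 1"] y0 P yz by auto
    then have z0: "z0 = 0" and P'_eq: "P' = P + 1" by auto
    have "defect2 (s - 1 - y0, 0) = 1" using low[of 0] D_y0[of 0] P by simp
    then have "s - 1 - y0 = y0" using uniq[OF mem, of "s - 1 - y0" 0] y0 P yz by auto
    moreover have "y0 \<noteq> 0" using D_y0[of 0] low[of 0] P by auto
    ultimately have s_ge: "3 \<le> s" using y0 by presburger
    \<comment> \<open>If \<open>(1, 0)\<close> were regular, \<open>s - 1\<close> would be 1 modulo
      \<open>k\<close> and \<open>ceil_div_reflect\<close> would make the whole row regular.\<close>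
    have "defect2 (1, 0) \<noteq> 0"
    proof
      assume "defect2 (1, 0) = 0"
      then have "cl 1 + cl (s - 1 - 1) = cl (s - 1)" using low[of 0 1] P by simp
      then obtain m where "s - 1 = k * m + 1" using ceil_div_reflect_one[OF k] by blast
      then have "defect2 (y0, 0) = 0" using ceil_div_reflect[OF k_pos \<open>s - 1 = k * m + 1\<close>, of y0] low[of 0 y0] P by simp
      then show False using D_y0[of 0] P by simp
    qed
    then have "y0 = 1" using others[OF mem, of 1 0] s_ge P yz by auto
    then have s3: "s = 3" using \<open>s - 1 - y0 = y0\<close> by simp
    show ?thesis
    proof (cases "P = 0")
      case True
      then show ?thesis using that(1) P'_eq s3 by simp
    next
      case False
      then have P1: "1 \<le> P" using P by simp
      \<comment> \<open>Regularity of this point determines \<delta>'. Then \<open>s' = 0\<close>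
        contradicts \<open>c > 0\<close>, and \<open>s' = 1\<close> contradicts
        \<open>R_nonpos\<close>.\<close>
      have "(0, 1) \<in> L" unfolding L_def using s P1 P'_eq by auto
      then have "defect2 (0, 1) = 0" using others[of "(0, 1)"] z0 yz by auto
      then have \<delta>': "\<delta>' = cl (2 - s') - 1"
        using high[of 1 0] P'_eq s3 k ceil_div_eq_1[of 2 k] by (simp add: f_def)
      consider "s' = 0" | "s' = 1" | "s' = 2" using s s3 by linarith
      then show ?thesis
      proof cases
        case 1
        then have "\<delta>' = 0" using \<delta>' k ceil_div_eq_1[of 2 k] by simp
        then show ?thesis using c_eq c_pos 1 by simp
      next
        case 2
        then have "\<delta>' = 0" using \<delta>' k ceil_div_eq_1[of 1 k] by simp
        then show ?thesis using R_nonpos 2 by simp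
      next
        case 3
        then show ?thesis using that(2) \<delta>' P1 P'_eq s3 by simp
      qed
    qed
  next
    case False
    then have P1: "1 \<le> P" using q0(1) yz by (auto simp: L_def)
    have s2: "2 \<le> s" using nontriv P1 by auto
    have y0f: "y0 \<le> f" using False q0(1) yz by (auto simp: L_def f_def)
    have mem: "(y, z) \<in> L" if "0 \<le> y" "y \<le> f" "P' - P \<le> z" "z < P'" for y z
      using that P s by (auto simp: L_def f_def)
    have D_y0: "defect2 (y0, z) = 1" if "P' - P \<le> z" for z
      using high[OF that] high[of z0] False q0(2) yz by simp
    \<comment> \<open>All points of the upper rectangle in column \<open>y0\<close> are exceptional,
      so its height \<open>P\<close> is one.\<close>
    have "P' - P = z0" "P' - 1 = z0"
      using uniq[OF mem D_y0, of "P' - P"] uniq[OF mem D_y0, of "P' - 1"] y0 y0f P P1 yz by auto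
    then have P_eq: "P = 1" and z0: "z0 = P' - 1" by auto
    \<comment> \<open>The bottom rectangle is regular now; testing it at \<open>(1, 0)\<close> gives
      \<open>s - 1\<close> modulo \<open>k\<close>.\<close>
    have "(1, 0) \<in> L" using s2 P by (auto simp: L_def)
    then have "defect2 (1, 0) = 0" using others[of "(1, 0)"] False P yz by fastforce
    then have "cl 1 + cl (s - 1 - 1) = cl (s - 1)" using low[of 0 1] P by simp
    then obtain m where m: "s - 1 = k * m + 1" using ceil_div_reflect_one[OF k] by blast
    have "0 \<le> k * m" using m s2 by simp
    then have m0: "0 \<le> m" using k by (auto simp: zero_le_mult_iff)
    have cl_s: "cl (s - 1) = m + 1"
      unfolding m using k ceil_div_mult_add[OF k_pos, of m 1] by (simp add: ceil_div_eq_1)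
    define D where "D y = cl y + cl (f - y) - (m + 1) - \<delta>'" for y
    have D1: "D y0 = 1" using D_y0[of z0] high[of z0 y0] False cl_s by (simp add: D_def)
    have D0: "y = y0" if "0 \<le> y" "y \<le> f" "D y = 1" for y
      using uniq[OF mem, of y z0] high[of z0 y] that False cl_s P z0 yz by (auto simp: D_def)
    have D01: "D y = 0" if "0 \<le> y" "y \<le> f" "y \<noteq> y0" for y
      using others[OF mem, of y z0] high[of z0 y] that False cl_s P z0 yz by (auto simp: D_def)
    have "D (f - y0) = D y0" by (simp add: D_def)
    then have mid: "f - y0 = y0" using D0[of "f - y0"] D1 y0 y0f by simp
    show ?thesis
    proof (cases "f = 0")
      case True
      then have "\<delta>' = - (m + 2)" using D1 mid by (simp add: D_def)
      moreover have "s = k * m + 2" "s' = s - 1" using m True by (auto simp: f_def)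
      ultimately show ?thesis using that(3) m0 P_eq by blast
    next
      case False
      then have y0_pos: "1 \<le> y0" using mid y0 by simp
      have "D (y0 - 1) = 0" using y0_pos y0f by (intro D01) auto
      then have "cl (y0 - 1) + cl (y0 + 1) = 2 * cl y0 - 1"
        using D1 mid by (simp add: D_def algebra_simps)
      then have "k dvd y0 - 1"
        using ceil_div_Suc[OF k_pos, of y0] ceil_div_Suc[OF k_pos, of "y0 - 1"]
        by (auto split: if_splits)
      then obtain j where j: "y0 - 1 = k * j" by blast
      \<comment> \<open>A shift by \<open>k\<close> to the left would leave \<open>D\<close>
        unchanged. As \<open>y0\<close> is 1 modulo \<open>k\<close>, only \<open>y0 = 1\<close>
        remains.\<close>
      have "y0 - k < 0"
      proof (rule ccontr)
        assume *: "\<not> y0 - k < 0"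
        have "cl (y0 - k) = cl y0 - 1" "cl (f - (y0 - k)) = cl (f - y0) + 1"
          using ceil_div_mult_add[OF k_pos, of 1 "f - y0"] ceil_div_mult_add[OF k_pos, of "- 1" y0]
          by (simp_all add: algebra_simps)
        then have "D (y0 - k) = D y0" by (simp add: D_def)
        then show False using D0[of "y0 - k"] D1 * y0f k by simp
      qed
      then have "0 \<le> k * j" "k * j < k * 1" using j y0_pos by linarith+
      then have "0 \<le> j" "j < 1"
        using k_pos by (auto simp only: mult_less_cancel_left_pos zero_le_mult_iff)
      then have "j = 0" by simp
      then have "y0 = 1" using j by simp
      then have f2: "f = 2" using mid by simp
      have "\<delta>' = - m" using D1 f2 \<open>y0 = 1\<close> ceil_div_eq_1[of 1 k] k by (simp add: D_def)
      moreover have "m \<noteq> 0" using f2 m s by (auto simp: f_def)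
      moreover have "s = k * m + 2" "s' = s - 3" using m f2 by (auto simp: f_def)
      ultimately show ?thesis using m0 P_eq by (intro that(4)) auto
    qed
  qed
qed

lemma pseudo_symmetric_cases:
  assumes "pseudo_symmetric S"
  obtains "P = 0" "P' = 1" "s = 3"
  | "1 \<le> P" "P' = P + 1" "s = 3" "s' = 2" "\<delta>' = - 1"
  | m where "0 \<le> m" "1 \<le> P" "P' = P + 1" "s' = 1" "s = k * m + 3" "\<delta> = - m"
  | m where "0 \<le> m" "1 \<le> P" "P' = P + 1" "s' = 2 * k - 1" "s = k * m + 2 * k + 1" "\<delta> = - (m + 2)"
  | m where "0 \<le> m" "P = 1" "s = k * m + 2" "s' = s - 1" "\<delta>' = - (m + 2)"
  | m where "1 \<le> m" "P = 1" "s = k * m + 2" "s' = s - 3" "\<delta>' = - m"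
proof (cases "\<omega> (s - s' - 1, P' - 1) \<le> \<omega> (s - 1, P' - P - 1)")
  case True
  have "\<omega> q \<le> \<omega> (s - 1, P' - P - 1)" if "q \<in> L" for q
    using omega_le_corner[OF that] True by simp
  then obtain q0 where q0: "q0 \<in> L" "defect2 q0 = 1"
      "\<forall>q\<in>L. q \<noteq> q0 \<longrightarrow> defect2 q = 0"
    using pseudo_symmetric_iff[OF corner2_mem _ refl2_mem omega_refl2] assms by blast
  \<comment> \<open>For \<open>s = 1\<close> both corners lie in column 0, and the first is strictly
    larger when \<open>P >= 1\<close>.\<close>
  have "P = 0 \<or> 2 \<le> s"
  proof (rule ccontr)
    assume "\<not> (P = 0 \<or> 2 \<le> s)"
    then have "s = 1" "s' = 0" "0 < c * P" using s P c_pos by auto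
    then show False using True by (simp add: \<omega>_def algebra_simps)
  qed
  show ?thesis
  proof (cases rule: defect2_cases[OF \<open>P = 0 \<or> 2 \<le> s\<close> q0])
    case 1
    then show ?thesis by (rule that(1))
  next
    case 2
    then show ?thesis by (rule that(2))
  next
    case (3 m)
    then show ?thesis by (rule that(5))
  next
    case (4 m)
    then show ?thesis by (rule that(6))
  qed
next
  case False
  have "1 \<le> P"
  proof (rule ccontr)
    assume "\<not> 1 \<le> P"
    then have "P = 0" using P by simp
    then show False using False omega_mono[of "s - s' - 1" "s - 1" "P' - 1" "P' - 1"] s by simp
  qed
  have "\<omega> q \<le> \<omega> (s - s' - 1, P' - 1)" if "q \<in> L" for q
    using omega_le_corner[OF that] False by simp
  then obtain q0 where q0: "q0 \<in> L" "defect1 (fst q0) = 1"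
      "\<forall>q\<in>L. q \<noteq> q0 \<longrightarrow> defect1 (fst q) = 0"
    using pseudo_symmetric_iff[OF corner1_mem _ refl1_mem omega_refl1] assms by blast
  show ?thesis
  proof (cases rule: defect1_cases[OF \<open>1 \<le> P\<close> q0])
    case (1 m)
    then show ?thesis using \<open>1 \<le> P\<close> by (intro that(3))
  next
    case (2 m)
    then show ?thesis using \<open>1 \<le> P\<close> by (intro that(4))
  qed
qed

section \<open>Converse: pseudo-symmetry of the shapes found\<close>

lemma mem_L: "q \<in> L \<longleftrightarrow> 0 \<le> fst q \<and> fst q < s \<and> 0 \<le> snd q \<and> snd q < P' \<and>
    (fst q < s - s' \<or> snd q < P' - P)"
  by (auto simp: L_def)

lemma cl_mult_add: "cl (k * m + y) = m + cl y"
  using ceil_div_mult_add[OF k_pos] .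

lemma cl_low: "cl (k * m + 1) = m + 1" "cl (k * m + 2) = m + 1"
  using k by (auto simp: cl_mult_add ceil_div_eq_1)

text \<open>The outer rectangle is one point, and the inner one is regular by
  \<open>ceil_div_reflect\<close>. The value \<open>m = 0\<close> serves (c.1), larger
  \<open>m\<close> serve (c.2).\<close>

lemma pseudo_symmetric_c:
  assumes "0 \<le> m" and P': "P' = P + 1" and s': "s' = 1" "s = k * m + 3" and \<delta>: "\<delta> = - m"
  shows "pseudo_symmetric S"
proof (rule pseudo_symmetricI[OF corner1_mem _ refl1_mem omega_refl1])
  have e: "s - s' - 1 = k * m + 1" using s' by simp
  show "1 \<le> fst (s - s' - 1, P' - 1)" unfolding e using assms(1) k by simp
  show "(k * m + 2, 0) \<in> L" unfolding L_def using assms(1) k s' P' P by simp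
  show "refl1 (k * m + 2, 0) = (k * m + 2, 0)" unfolding refl1_def using s' P' by simp
  have "defect1 (k * m + 2) = cl (k * m + 2) + cl (k * m + 2) - cl (k * m + 1) + \<delta>"
    unfolding defect1_def e using s' by (simp add: algebra_simps)
  then show "defect1 (fst (k * m + 2, 0)) = 1" using \<delta> by (simp add: cl_low)
  fix q assume q: "q \<in> L" "q \<noteq> (k * m + 2, 0)"
  show "defect1 (fst q) = 0"
  proof (cases "fst q \<le> k * m + 1")
    case True
    then show ?thesis
      using ceil_div_reflect[OF k_pos, of "k * m + 1" m "fst q"] by (simp add: defect1_def e)
  next
    case False
    then have "q = (k * m + 2, 0)" using q(1)[unfolded mem_L] s' P' by (auto simp: prod_eq_iff)
    then show ?thesis using q(2) by simp
  qed
qed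

text \<open>The outer rectangle is a row of \<open>2 * k - 1\<close> points. Of \<open>i + 1\<close>
  and \<open>2 * k + 1 - i\<close> one is at most \<open>k\<close> and the other larger, giving
  \<open>1 + 2\<close>, except at the centre \<open>i = k\<close>, where both round up to 2.\<close>

lemma pseudo_symmetric_d:
  assumes "0 \<le> m" and P': "P' = P + 1" and s': "s' = 2 * k - 1" "s = k * m + 2 * k + 1"
    and \<delta>: "\<delta> = - (m + 2)"
  shows "pseudo_symmetric S"
proof (rule pseudo_symmetricI[OF corner1_mem _ refl1_mem omega_refl1])
  have e: "s - s' - 1 = k * m + 1" using s' by simp
  have high: "defect1 (k * m + 1 + i) = cl (i + 1) + cl (2 * k + 1 - i) - 3" if "0 < i" for i
  proof -
    have "defect1 (k * m + 1 + i) = cl (k * m + (i + 1)) + cl (k * m + (2 * k + 1 - i)) - cl (k * m + 1) + \<delta>"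
      unfolding defect1_def e using that s' by (simp add: algebra_simps)
    then show ?thesis unfolding cl_mult_add cl_low(1) using \<delta> k by (simp add: ceil_div_eq_1)
  qed
  have cl_2: "cl y = 2" if "k < y" "y \<le> 2 * k" for y
    using that k by (intro ceil_div_eqI) auto
  show "1 \<le> fst (s - s' - 1, P' - 1)" unfolding e using assms(1) k by simp
  show "(k * m + 1 + k, 0) \<in> L" unfolding L_def using assms(1) k s' P' P by simp
  show "refl1 (k * m + 1 + k, 0) = (k * m + 1 + k, 0)" unfolding refl1_def using s' P' k by simp
  show "defect1 (fst (k * m + 1 + k, 0)) = 1"
    using high[of k] k cl_2[of "k + 1"] by (simp add: algebra_simps)
  fix q assume q: "q \<in> L" "q \<noteq> (k * m + 1 + k, 0)"
  show "defect1 (fst q) = 0"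
  proof (cases "fst q \<le> k * m + 1")
    case True
    then show ?thesis
      using ceil_div_reflect[OF k_pos, of "k * m + 1" m "fst q"] by (simp add: defect1_def e)
  next
    case False
    define i where "i = fst q - (k * m + 1)"
    have y: "fst q = k * m + 1 + i" by (simp add: i_def)
    have z: "snd q = 0" using q(1)[unfolded mem_L] False s' P' by auto
    have i: "0 < i" "i < 2 * k" "i \<noteq> k"
      using q(1)[unfolded mem_L] q(2) False s' z by (auto simp: i_def prod_eq_iff)
    consider "i < k" | "k < i" using i by linarith
    then show ?thesis
    proof cases
      case 1
      then show ?thesis unfolding y high[OF i(1)]
        using i cl_2[of "2 * k + 1 - i"] ceil_div_eq_1[of "i + 1" k] by simp
    next
      case 2
      then show ?thesis unfolding y high[OF i(1)]
        using i cl_2[of "i + 1"] ceil_div_eq_1[of "2 * k + 1 - i" k] by simp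
    qed
  qed
qed

lemma pseudo_symmetric_e:
  assumes "0 \<le> m" and P1: "P = 1" and s': "s = k * m + 2" "s' = s - 1"
    and \<delta>': "\<delta>' = - (m + 2)"
  shows "pseudo_symmetric S"
proof (rule pseudo_symmetricI[OF corner2_mem _ refl2_mem omega_refl2])
  have s1: "s - 1 = k * m + 1" using s' by simp
  show "1 \<le> fst (s - 1, P' - P - 1)" unfolding s1 using assms(1) k by simp
  show "(0, P' - 1) \<in> L" unfolding L_def using s s'(2) P1 P by simp
  show "refl2 (0, P' - 1) = (0, P' - 1)" unfolding refl2_def using s' P1 by simp
  show "defect2 (0, P' - 1) = 1"
    unfolding defect2_def s1 using s' P1 \<delta>' by (simp add: cl_low)
  fix q assume q: "q \<in> L" "q \<noteq> (0, P' - 1)"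
  show "defect2 q = 0"
  proof (cases "snd q < P' - P")
    case True
    then show ?thesis
      using ceil_div_reflect[OF k_pos, of "k * m + 1" m "fst q"] by (simp add: defect2_def s1)
  next
    case False
    then have "q = (0, P' - 1)" using q(1)[unfolded mem_L] s' P1 by (auto simp: prod_eq_iff)
    then show ?thesis using q(2) by simp
  qed
qed

text \<open>The upper rectangle is a row of three points: \<open>cl y + cl (2 - y)\<close> is 2 at
  its centre and 1 at its ends.\<close>

lemma pseudo_symmetric_f:
  assumes "1 \<le> m" and P1: "P = 1" and s': "s = k * m + 2" "s' = s - 3"
    and \<delta>': "\<delta>' = - m"
  shows "pseudo_symmetric S"
proof (rule pseudo_symmetricI[OF corner2_mem _ refl2_mem omega_refl2])
  have s1: "s - 1 = k * m + 1" using s' by simp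
  have high: "defect2 (y, P' - 1) = cl y + cl (2 - y) - 1" for y
    unfolding defect2_def s1 using s' P1 \<delta>' by (simp add: cl_low)
  show "1 \<le> fst (s - 1, P' - P - 1)" unfolding s1 using assms(1) k by simp
  show "(1, P' - 1) \<in> L" unfolding L_def using s s' P1 P by simp
  show "refl2 (1, P' - 1) = (1, P' - 1)" unfolding refl2_def using s' P1 by simp
  show "defect2 (1, P' - 1) = 1" unfolding high using k by (simp add: ceil_div_eq_1)
  fix q assume q: "q \<in> L" "q \<noteq> (1, P' - 1)"
  show "defect2 q = 0"
  proof (cases "snd q < P' - P")
    case True
    then show ?thesis
      using ceil_div_reflect[OF k_pos, of "k * m + 1" m "fst q"] by (simp add: defect2_def s1)
  next
    case False
    then have "q = (0, P' - 1) \<or> q = (2, P' - 1)"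
      using q(1)[unfolded mem_L] q(2) s' P1 by (auto simp: prod_eq_iff)
    then show ?thesis using high[of 0] high[of 2] k ceil_div_eq_1[of 2 k] by auto
  qed
qed

text \<open>The bottom row has three points, the middle one exceptional. Above it there is nothing
  or the column \<open>y = 0\<close>, on which \<open>\<delta>' = - 1\<close> makes the defect
  vanish.\<close>

lemma pseudo_symmetric_ab:
  assumes P': "P' = P + 1" and s3: "s = 3" and ab: "P = 0 \<or> s' = 2 \<and> \<delta>' = - 1"
  shows "pseudo_symmetric S"
proof (rule pseudo_symmetricI[OF corner2_mem _ refl2_mem omega_refl2])
  have cl1: "cl 1 = 1" "cl 2 = 1" using k by (auto simp: ceil_div_eq_1)
  show "1 \<le> fst (s - 1, P' - P - 1)" using s3 by simp
  show "(1, 0) \<in> L" unfolding L_def using s3 P' P by simp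
  show "refl2 (1, 0) = (1, 0)" unfolding refl2_def using s3 P' by simp
  show "defect2 (1, 0) = 1" unfolding defect2_def using s3 P' by (simp add: cl1)
  fix q assume q: "q \<in> L" "q \<noteq> (1, 0)"
  show "defect2 q = 0"
  proof (cases "snd q < P' - P")
    case True
    then have "q = (0, 0) \<or> q = (2, 0)"
      using q(1)[unfolded mem_L] q(2) s3 P' by (auto simp: prod_eq_iff)
    then show ?thesis unfolding defect2_def using s3 P' by (auto simp: cl1)
  next
    case False
    then have "fst q = 0" "s' = 2" "\<delta>' = - 1" using q(1)[unfolded mem_L] ab s3 P' by auto
    then show ?thesis unfolding defect2_def using False s3 by (simp add: cl1)
  qed
qed

text \<open>Here \<open>a = 3\<close>, and the Apery set is \<open>0\<close>, \<open>3 + d\<close>,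
  \<open>3 + 2 * d\<close>.\<close>

lemma S_eq_three:
  assumes "P = 0" "P' = 1" "s = 3"
  shows "S = num_semigroup {3, 3 + d, 3 + 2 * d}" (is "_ = ?T")
proof
  have a3: "a = 3" using a_eq assms by simp
  have gens: "3 \<in> ?T" "3 + d \<in> ?T" "3 + 2 * d \<in> ?T" by (auto intro: num_semigroup_generator)
  show "S \<subseteq> ?T"
  proof
    fix x assume "x \<in> S"
    obtain q t where q: "q \<in> L" "x - \<omega> q = a * t" using L_cover[of x] by blast
    then have x: "x = \<omega> q + a * t" by simp
    then have t: "0 \<le> t" using \<open>x \<in> S\<close> omega_add_mult_mem_iff[OF q(1)] by blast
    have "q = (0, 0) \<or> q = (1, 0) \<or> q = (2, 0)"
      using q(1)[unfolded mem_L] assms by (auto simp: prod_eq_iff)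
    then have "\<omega> q \<in> {0, 3 + d, 3 + 2 * d}"
      unfolding \<omega>_def using a3 k ceil_div_eq_1[of 1 k] ceil_div_eq_1[of 2 k] by auto
    then have "\<omega> q \<in> ?T" using gens by (auto intro: num_semigroup.zero)
    moreover have "a * t \<in> ?T"
      using num_semigroup_mult[OF gens(1) t] a3 by (simp add: mult.commute)
    ultimately show "x \<in> ?T" unfolding x by (rule num_semigroup_add)
  qed
  show "?T \<subseteq> S"
    using gen_mem[of 0] gen_mem[of 1] gen_mem[of 2] k a3 by (intro num_semigroup_subsetI) auto
qed

section \<open>From the shapes to the conditions on \<open>a\<close>, \<open>d\<close>,
  \<open>c\<close>\<close>

lemma params_b:
  assumes "P' = P + 1" "s = 3" "s' = 2" "\<delta>' = - 1"
  shows "a * (c - 1) = 2 * (c + d)" "odd c"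
proof -
  have "a = P + 3" "c = 2 * \<delta> + 3" "d = (P + 1) * \<delta> + P"
    using a_eq c_eq d_eq assms by (simp_all add: algebra_simps)
  then show "a * (c - 1) = 2 * (c + d)" "odd c" by (simp_all add: algebra_simps)
qed

text \<open>As \<open>a = 2 * P + 3\<close> and \<open>d = - (P * \<delta>')\<close>, coprimality
  excludes 3 as a divisor of \<open>P\<close>, and the upper bound on \<open>a\<close> reduces to
  \<open>P <= d\<close>.\<close>

lemma params_c1:
  assumes "P' = P + 1" "s' = 1" "s = 3" "\<delta> = 0"
  shows "a mod 6 = 1 \<or> a mod 6 = 5" "c * (a - 3) = 6 * d" "a \<le> 2 * k * d + 3"
proof -
  have eqs: "a = 2 * P + 3" "c = - (3 * \<delta>')" "d = - (P * \<delta>')"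
    using a_eq c_eq d_eq assms by (simp_all add: algebra_simps)
  then show "c * (a - 3) = 6 * d" by simp
  have "\<not> 3 dvd P"
  proof
    assume "3 dvd P"
    then have "3 dvd a" "3 dvd d" using eqs by simp_all
    then show False using cop not_coprimeI[of 3 a d] by auto
  qed
  then show "a mod 6 = 1 \<or> a mod 6 = 5" using eqs(1) by presburger
  have "k * \<delta>' < 0" using R_nonpos assms(2) by simp
  then have "1 \<le> - \<delta>'" using k by (simp add: mult_less_0_iff)
  then have "P * 1 \<le> P * - \<delta>'" using P by (intro mult_left_mono) auto
  then have "P \<le> d" using eqs(3) by simp
  moreover have "1 * d \<le> k * d" using k d_pos by (intro mult_right_mono) auto
  ultimately show "a \<le> 2 * k * d + 3" using eqs(1) by simp
qed

text \<open>Positivity of the witness \<open>\<delta> - \<delta>'\<close> for \<mu> in (c.2) and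
  (d).\<close>

lemma step_coeff_pos:
  assumes "0 \<le> n" "c + n * d = (\<delta> - \<delta>') * a"
  shows "1 \<le> \<delta> - \<delta>'"
proof -
  have "0 < (\<delta> - \<delta>') * a" using assms c_pos d_pos by (metis add_pos_nonneg mult_nonneg_nonneg order_less_imp_le)
  then show ?thesis using a_pos by (simp add: zero_less_mult_iff)
qed

text \<open>With \<lambda> = \<open>m\<close> and \<open>n = P\<close> the equations are the
  determinant, the difference of the two basis relations, and \<open>basis1\<close>.\<close>

lemma params_c2:
  assumes "0 \<le> m" "P' = P + 1" "s' = 1" "s = k * m + 3" "\<delta> = - m"
  shows "a = (2 + m * k) * (P + 1) + 1" "c + (2 + m * k) * d = (\<delta> - \<delta>') * a" "1 \<le> \<delta> - \<delta>'"
    "m * (a + k * d) = c * P - 3 * d"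
proof -
  show "a = (2 + m * k) * (P + 1) + 1" using a_eq assms by (simp add: algebra_simps)
  show *: "c + (2 + m * k) * d = (\<delta> - \<delta>') * a"
    using basis1 basis2 assms(2-4) by (simp add: algebra_simps)
  show "1 \<le> \<delta> - \<delta>'" using step_coeff_pos[OF _ *] assms(1) k by simp
  show "m * (a + k * d) = c * P - 3 * d" using basis1 assms by (simp add: algebra_simps)
qed

text \<open>The sums are left unsimplified so that they match (d) literally at \<lambda> =
  \<open>m + 2\<close> and \<open>v = P - 1\<close>.\<close>

lemma params_d:
  assumes "0 \<le> m" "P' = P + 1" "s' = 2 * k - 1" "s = k * m + 2 * k + 1" "\<delta> = - (m + 2)"
  shows "a = (P - 1 + 1) * (2 + (m + 2 - 2) * k) + ((m + 2) * k + 1)"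
    "c + (2 + (m + 2 - 2) * k) * d = (\<delta> - \<delta>') * a" "1 \<le> \<delta> - \<delta>'"
    "(m + 2) * (a + k * d) = c * (P - 1 + 1) - d"
proof -
  show "a = (P - 1 + 1) * (2 + (m + 2 - 2) * k) + ((m + 2) * k + 1)"
    using a_eq assms by (simp add: algebra_simps)
  show *: "c + (2 + (m + 2 - 2) * k) * d = (\<delta> - \<delta>') * a"
    using basis1 basis2 assms(2-4) by (simp add: algebra_simps)
  show "1 \<le> \<delta> - \<delta>'" using step_coeff_pos[OF _ *] assms(1) k by simp
  show "(m + 2) * (a + k * d) = c * (P - 1 + 1) - d" using basis1 assms by (simp add: algebra_simps)
qed

text \<open>The witnesses are \<open>q1 = P'\<close>, \<open>s0 = s\<close> and the Rodseth term
  \<open>R0 = s + k * \<delta>\<close>, also in \<open>params_f\<close>.\<close>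

lemma params_e:
  assumes "P = 1" "s = k * m + 2" "s' = s - 1" "\<delta>' = - (m + 2)"
  shows "a = (P' - 1) * s + 1" "a + k * d = P' * (s + k * \<delta>) + 2 * k - 1"
    "k * c = (s + k * \<delta> + 2 * k - 1) * (s - 1) + 2 * k - 1"
  unfolding a_eq d_eq c_eq assms by (simp_all add: algebra_simps)

lemma params_f:
  assumes "P = 1" "s = k * m + 2" "s' = s - 3" "\<delta>' = - m"
  shows "a = (P' - 1) * s + 3" "a + k * d = P' * (s + k * \<delta>) + 1"
    "k * c = (s + k * \<delta> + 1) * (s - 3) + 3"
  unfolding a_eq d_eq c_eq assms by (simp_all add: algebra_simps)

end

text \<open>Euclid's algorithm on \<open>s\<close> and \<open>s'\<close> with quotients rounded up,
  stopped once \<open>s' + k * \<delta>'\<close> is not positive. Each step is a unimodular change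
  of basis, so the three determinant equations persist.\<close>

lemma aa_lshape_reduce:
  fixes k s s' P P' \<delta> \<delta>' a d c :: int
  assumes "0 \<le> s'" "s' < s" "0 \<le> P" "P < P'"
    and "a = s * P' - s' * P" "d = P' * \<delta> - P * \<delta>'" "c = s' * \<delta> - s * \<delta>'" "0 < s + k * \<delta>"
    and k: "2 \<le> k" and dc: "0 < d" "0 < c" "coprime a d"
  shows "\<exists>s s' P P' \<delta> \<delta>'. aa_lshape k s s' P P' \<delta> \<delta>' a d c"
  using assms(1-8)
proof (induction "nat s'" arbitrary: s s' P P' \<delta> \<delta>' rule: less_induct)
  case less
  show ?case
  proof (cases "s' + k * \<delta>' \<le> 0")
    case True
    then have "aa_lshape k s s' P P' \<delta> \<delta>' a d c" using less.prems k dc by unfold_locales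
    then show ?thesis by blast
  next
    case False
    \<comment> \<open>At \<open>s' = 0\<close> the equation for \<open>c\<close> makes \<delta>'
      negative, so the algorithm has stopped by then.\<close>
    have s'_pos: "0 < s'"
    proof (rule ccontr)
      assume "\<not> 0 < s'"
      then have "s' = 0" using less.prems(1) by simp
      then have "s * \<delta>' < 0" using less.prems(7) dc by simp
      then have "\<delta>' < 0" using less.prems(1,2) by (simp add: mult_less_0_iff)
      then have "k * \<delta>' < 0" using k by (simp add: mult_less_0_iff)
      then show False using False \<open>s' = 0\<close> by simp
    qed
    \<comment> \<open>Rounding up puts \<open>q * s' - s\<close> between 0 and
      \<open>s' - 1\<close>; moreover \<open>q >= 2\<close>, which keeps the \<open>P\<close>
      sequence increasing.\<close>
    define q where "q = ceil_div s s'"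
    have q: "s \<le> s' * q" "s' * q < s + s'"
      using ceil_div_ge[OF s'_pos] ceil_div_less[OF s'_pos] by (auto simp: q_def)
    have "s' * 1 < s' * q" using q less.prems(2) by linarith
    then have "1 < q" using s'_pos by (simp only: mult_less_cancel_left_pos)
    then have "2 * P' \<le> q * P'" using less.prems by (intro mult_right_mono) auto
    then have P'': "P' < q * P' - P" using less.prems(4) by linarith
    show ?thesis
    proof (rule less.hyps[of "q * s' - s" s' P' "q * P' - P" \<delta>' "q * \<delta>' - \<delta>"])
      show "nat (q * s' - s) < nat s'" using q s'_pos by (simp add: mult.commute)
      show "0 \<le> q * s' - s" "q * s' - s < s'" using q by (simp_all add: mult.commute)
      show "0 \<le> P'" "P' < q * P' - P" using less.prems P'' by simp_all
      show "a = s' * (q * P' - P) - (q * s' - s) * P'"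
        "d = (q * P' - P) * \<delta>' - P' * (q * \<delta>' - \<delta>)"
        "c = (q * s' - s) * \<delta>' - s' * (q * \<delta>' - \<delta>)"
        using less.prems by (simp_all add: algebra_simps)
      show "0 < s' + k * \<delta>'" using False by simp
    qed
  qed
qed

text \<open>The algorithm starts from the basis \<open>(a, 0)\<close>, \<open>(- s0, 1)\<close>,
  where \<open>d * s0\<close> is congruent to \<open>c\<close> modulo \<open>a\<close>.\<close>

lemma aa_lshape_exists:
  fixes a d c k :: int
  assumes "0 < a" "0 < d" "0 < c" "2 \<le> k" "coprime a d"
  obtains s s' P P' \<delta> \<delta>' where "aa_lshape k s s' P P' \<delta> \<delta>' a d c"
proof -
  obtain u v where uv: "u * a + v * d = 1"
    using assms(5) bezout_int[of a d] by auto
  define s0 where "s0 = (v * c) mod a"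
  have "a dvd v * c - s0" by (simp add: s0_def minus_mod_eq_mult_div)
  then obtain w where w: "v * c - s0 = a * w" by blast
  have "d * s0 - c = a * (- u * c - d * w)"
    using arg_cong[OF uv, of "\<lambda>t. t * c"] arg_cong[OF w, of "\<lambda>t. d * t"]
    by (simp add: algebra_simps)
  then obtain \<delta>' where "c = s0 * d - a * \<delta>'" by (metis add_diff_cancel_left' diff_add_cancel mult.commute)
  then have "\<exists>s s' P P' \<delta> \<delta>'. aa_lshape k s s' P P' \<delta> \<delta>' a d c"
    using assms by (intro aa_lshape_reduce[of s0 a 0 1 a d d \<delta>' c k]) (auto simp: s0_def add_pos_pos)
  then show ?thesis using that by blast
qed

section \<open>Generators with \<open>gcd a d > 1\<close>\<close>

lemma Greatest_int:
  fixes Q :: "int \<Rightarrow> bool"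
  assumes "Q x0" and bound: "\<And>x. Q x \<Longrightarrow> x \<le> M"
  shows "Q (GREATEST x. Q x)" and "Q x \<Longrightarrow> x \<le> (GREATEST x. Q x)"
proof -
  define A where "A = {x. Q x \<and> x0 \<le> x}"
  have A: "finite A" "A \<noteq> {}"
    using assms by (auto simp: A_def intro!: finite_subset[of _ "{x0..M}"])
  have max: "Q (Max A)" using Max_in[OF A] by (simp add: A_def)
  have le: "x \<le> Max A" if "Q x" for x
  proof (cases "x0 \<le> x")
    case True
    then show ?thesis using Max_ge[OF A(1), of x] that by (simp add: A_def)
  next
    case False
    then show ?thesis using Max_in[OF A] by (simp add: A_def)
  qed
  have "(GREATEST x. Q x) = Max A" by (rule Greatest_equality) (use max le in auto)
  then show "Q (GREATEST x. Q x)" "Q x \<Longrightarrow> x \<le> (GREATEST x. Q x)" using max le by auto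
qed

lemma num_semigroup_nonneg:
  assumes "x \<in> num_semigroup B" "\<And>b. b \<in> B \<Longrightarrow> 0 \<le> b"
  shows "0 \<le> (x::int)"
  using assms(1) by induction (auto dest: assms(2))

text \<open>The defining equation of pseudo-symmetry, applied to negative numbers, already bounds the
  complement of the semigroup, so that \<open>GREATEST\<close> is meaningful.\<close>

lemma pseudo_symmetric_frobenius:
  assumes ps: "pseudo_symmetric (num_semigroup B)" and B: "\<And>b. b \<in> B \<Longrightarrow> 0 \<le> b"
  defines "g \<equiv> frobenius (num_semigroup B)"
  shows "g \<notin> num_semigroup B" and "g < x \<Longrightarrow> x \<in> num_semigroup B"
    and "x \<in> num_semigroup B \<or> g - x \<in> num_semigroup B \<longleftrightarrow> x \<noteq> g div 2"
proof -
  let ?S = "num_semigroup B"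
  have eq: "?S \<union> {g - s | s. s \<in> ?S} = UNIV - {g div 2}"
    using ps unfolding pseudo_symmetric_def g_def Let_def by blast
  have mirror: "x \<in> {g - y | y. y \<in> ?S} \<longleftrightarrow> g - x \<in> ?S" for x
  proof
    assume "g - x \<in> ?S"
    moreover have "x = g - (g - x)" by simp
    ultimately show "x \<in> {g - y | y. y \<in> ?S}" by blast
  qed auto
  show iff: "x \<in> ?S \<or> g - x \<in> ?S \<longleftrightarrow> x \<noteq> g div 2" for x
    using eq mirror[of x] by blast
  have bound: "x \<le> max g (g div 2)" if "x \<notin> ?S" for x
  proof (rule ccontr)
    assume "\<not> x \<le> max g (g div 2)"
    then have "g - x \<in> ?S" "g - x < 0" using iff[of x] that by auto
    then show False using num_semigroup_nonneg[of "g - x" B] B by simp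
  qed
  have neg: "- 1 \<notin> ?S" using num_semigroup_nonneg[of "- 1" B] B by auto
  have g: "g = (GREATEST x. x \<notin> ?S)" by (simp add: g_def frobenius_def)
  show "g \<notin> ?S" unfolding g
  proof (rule Greatest_int(1)[where Q = "\<lambda>x. x \<notin> ?S"])
    show "- 1 \<notin> ?S" by (fact neg)
    show "y \<le> max g (g div 2)" if "y \<notin> ?S" for y using that by (rule bound)
  qed
  show "x \<in> ?S" if "g < x"
  proof (rule ccontr)
    assume "x \<notin> ?S"
    have "x \<le> g" unfolding g
    proof (rule Greatest_int(2)[where Q = "\<lambda>x. x \<notin> ?S"])
      show "- 1 \<notin> ?S" by (fact neg)
      show "y \<le> max g (g div 2)" if "y \<notin> ?S" for y using that by (rule bound)
    qed fact
    then show False using that by simp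
  qed
qed

text \<open>Modulo \<open>n = gcd a d\<close> only the number \<open>z\<close> of copies of
  \<open>c\<close> is visible. Both \<open>h = g div 2\<close> and \<open>g - h\<close> are a
  multiple of \<open>n\<close> plus fewer than \<open>n\<close> copies of \<open>c\<close>, and
  changing that number preserves non-membership, so \<open>h\<close> is not the only exceptional
  integer.\<close>

lemma pseudo_symmetric_coprime:
  fixes a d c k :: int
  assumes "0 < a" "0 < d" "0 < c" "2 \<le> k" and Gcd: "Gcd (aa_gens a d c k) = 1"
    and ps: "pseudo_symmetric (num_semigroup (aa_gens a d c k))"
  shows "gcd a d = 1"
proof (rule ccontr)
  assume ne: "gcd a d \<noteq> 1"
  define n where "n = gcd a d"
  define S where "S = num_semigroup (aa_gens a d c k)"
  define g where "g = frobenius S"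
  have "0 < n" using assms(1) by (simp add: n_def)
  then have n: "2 \<le> n" using ne unfolding n_def by linarith
  have n_dvd: "n dvd a" "n dvd d" by (simp_all add: n_def)
  have "gcd n c dvd Gcd (aa_gens a d c k)"
  proof (rule Gcd_greatest)
    fix b assume "b \<in> aa_gens a d c k"
    then show "gcd n c dvd b" using n_dvd by (auto intro: dvd_add dvd_mult dvd_trans[OF gcd_dvd1])
  qed
  then have "gcd n c dvd 1" unfolding Gcd .
  then have cop: "coprime n c" by (simp only: is_unit_gcd)
  have gens: "0 \<le> b" if "b \<in> aa_gens a d c k" for b
    using that assms(1-3) by auto
  note frob = pseudo_symmetric_frobenius[OF ps gens, folded S_def, folded g_def]
  have c_mult: "z * c \<in> S" if "0 \<le> z" for z
    unfolding S_def by (intro num_semigroup_mult num_semigroup_generator that) auto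
  have decomp: "\<exists>v z. x = v + z * c \<and> v \<in> S \<and> n dvd v \<and> 0 \<le> z" if "x \<in> S" for x
    using that unfolding S_def
  proof induction
    case zero
    show ?case by (rule exI[of _ 0], rule exI[of _ 0]) (simp add: num_semigroup.zero)
  next
    case (add x b)
    then obtain v z where vz: "x = v + z * c" "v \<in> num_semigroup (aa_gens a d c k)" "n dvd v" "0 \<le> z"
      by blast
    have "b = c \<or> (\<exists>i. b = a + i * d)" using add.hyps(2) by blast
    then consider "b = c" | "n dvd b" using n_dvd by (metis dvd_add dvd_mult)
    then show ?case
    proof cases
      case 1
      then have "x + b = v + (z + 1) * c" using vz(1) by (simp add: algebra_simps)
      moreover have "0 \<le> z + 1" using vz(4) by simp
      ultimately show ?thesis using vz(2,3) by blast
    next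
      case 2
      then have "x + b = (v + b) + z * c" "n dvd v + b" using vz by auto
      moreover have "v + b \<in> num_semigroup (aa_gens a d c k)"
        using vz(2) add.hyps(2) by (rule num_semigroup.add)
      ultimately show ?thesis using vz(4) by blast
    qed
  qed
  \<comment> \<open>The number of copies of \<open>c\<close> in any representation is
    \<open>z\<close> plus a nonnegative multiple of \<open>n\<close>; the surplus copies can stay
    with \<open>u\<close>.\<close>
  have mem_iff: "u + z * c \<in> S \<longleftrightarrow> u \<in> S" if "n dvd u" "0 \<le> z" "z < n" for u z
  proof
    assume "u \<in> S"
    then show "u + z * c \<in> S" using c_mult[OF that(2)] unfolding S_def by (rule num_semigroup_add)
  next
    assume "u + z * c \<in> S"
    then obtain v z' where v: "u + z * c = v + z' * c" "v \<in> S" "n dvd v" "0 \<le> z'"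
      using decomp by blast
    have "(z' - z) * c = u - v" using v(1) by (simp add: algebra_simps)
    then have "n dvd (z' - z) * c" using that(1) v(3) by simp
    then have "n dvd z' - z" using cop by (simp add: coprime_dvd_mult_left_iff)
    then obtain w where w: "z' - z = n * w" by blast
    have "n * - 1 < n * w" using w that v(4) by simp
    then have "- 1 < w" using \<open>0 < n\<close> by (simp only: mult_less_cancel_left_pos)
    then have "0 \<le> w" by simp
    then have "(z' - z) * c \<in> S" using w n by (intro c_mult) simp
    with v(2) have "v + (z' - z) * c \<in> S" unfolding S_def by (rule num_semigroup_add)
    moreover have "v + (z' - z) * c = u" using v(1) by (simp add: algebra_simps)
    ultimately show "u \<in> S" by simp
  qed
  \<comment> \<open>A representation of \<open>g + c\<close> containing a copy of \<open>c\<close>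
    would put \<open>g\<close> into \<open>S\<close>.\<close>
  have g_dvd: "n dvd g + c"
  proof -
    obtain v z where v: "g + c = v + z * c" "v \<in> S" "n dvd v" "0 \<le> z"
      using decomp[of "g + c"] frob(2)[of "g + c"] assms(3) by auto
    have "z = 0"
    proof (rule ccontr)
      assume "z \<noteq> 0"
      then have "(z - 1) * c \<in> S" using v(4) by (intro c_mult) simp
      with v(2) have "v + (z - 1) * c \<in> S" unfolding S_def by (rule num_semigroup_add)
      moreover have "v + (z - 1) * c = g" using v(1) by (simp add: algebra_simps)
      ultimately show False using frob(1) by simp
    qed
    then show ?thesis using v by simp
  qed
  define h where "h = g div 2"
  obtain p q where pq: "p * n + q * c = 1" using cop bezout_int[of n c] by auto
  define z where "z = (q * h) mod n"
  define u where "u = h - z * c"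
  have z: "0 \<le> z" "z < n" using n by (auto simp: z_def)
  have "n dvd q * h - z" by (simp add: z_def minus_mod_eq_mult_div)
  moreover have "u = n * (p * h) + c * (q * h - z)"
    using arg_cong[OF pq, of "\<lambda>t. t * h"] by (simp add: u_def algebra_simps)
  ultimately have u: "n dvd u" by simp
  have h: "h = u + z * c" by (simp add: u_def)
  have notin: "h \<notin> S" "g - h \<notin> S" using frob(3)[of h] by (auto simp: h_def)
  then have "u \<notin> S" using mem_iff[OF u z] h by simp
  \<comment> \<open>Any other residue will do; \<open>n >= 2\<close> provides one.\<close>
  define z' :: int where "z' = (if z = 0 then 1 else 0)"
  have z': "0 \<le> z'" "z' < n" "z' \<noteq> z" using n by (auto simp: z'_def)
  have "u + z' * c \<notin> S" using mem_iff[OF u z'(1,2)] \<open>u \<notin> S\<close> by simp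
  moreover have "u + z' * c \<noteq> h" using h z'(3) assms(3) by simp
  ultimately have "g - (u + z' * c) \<in> S" using frob(3) by (auto simp: h_def)
  moreover define w where "w = g + c - u - n * c"
  have w: "n dvd w" using g_dvd u by (simp add: w_def)
  have "g - (u + z' * c) = w + (n - 1 - z') * c" "g - h = w + (n - 1 - z) * c"
    by (simp_all add: w_def h algebra_simps)
  ultimately show False
    using mem_iff[OF w, of "n - 1 - z'"] mem_iff[OF w, of "n - 1 - z"] z z' notin(2) by simp
qed

section \<open>The classification\<close>

lemma cong_add_multE:
  fixes x y k :: int
  assumes "[x = y] (mod k)"
  obtains m where "x = k * m + y"
  using assms by (auto simp: cong_iff_dvd_diff dvd_def algebra_simps)

section \<open>Sufficiency: an L-shape from each set of parameters\<close>

lemma pseudo_symmetric_if_b: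
  assumes "0 < a" "0 < d" "0 < c" "2 \<le> k" "coprime a d"
    and b: "a * (c - 1) = 2 * (c + d)" "odd c"
  shows "pseudo_symmetric (num_semigroup (aa_gens a d c k))"
proof -
  \<comment> \<open>The shape comes from inverting \<open>params_b\<close>, where
    \<open>a = P + 3\<close> and \<open>c = 2 * \<delta> + 3\<close>; thus \<open>j\<close> is
    \<delta>.\<close>
  from b(2) obtain i where "c = 2 * i + 1" by (elim oddE)
  then obtain j where j: "c = 2 * j + 3" using that[of "i - 1"] by simp
  have d: "d = a * (j + 1) - 2 * j - 3" using b(1) j by (simp add: algebra_simps)
  have "0 < a * (c - 1)" using b(1) assms(2,3) by simp
  then have j0: "0 \<le> j" using assms(1) j by (simp add: zero_less_mult_iff)
  have "3 \<le> a"
  proof (rule ccontr)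
    assume "\<not> 3 \<le> a"
    then have "a * (j + 1) \<le> 2 * (j + 1)" using j0 by (intro mult_right_mono) auto
    then show False using d assms(2) by simp
  qed
  have lshape: "aa_lshape k 3 2 (a - 3) (a - 2) j (- 1) a d c"
  proof unfold_locales
    show "0 < 3 + k * j" using j0 assms(4) by (simp add: add_pos_nonneg)
    show "coprime a d" by fact
  qed (use assms(1-4) j d \<open>3 \<le> a\<close> in \<open>simp_all add: algebra_simps\<close>)
  show ?thesis by (rule aa_lshape.pseudo_symmetric_ab[OF lshape]) auto
qed

lemma pseudo_symmetric_if_c1:
  assumes "0 < a" "0 < d" "0 < c" "2 \<le> k" "coprime a d"
    and c1: "a mod 6 = 1 \<or> a mod 6 = 5" "c * (a - 3) = 6 * d"
  shows "pseudo_symmetric (num_semigroup (aa_gens a d c k))"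
proof -
  \<comment> \<open>In terms of \<open>params_c1\<close>, \<open>n\<close> is \<open>P\<close>, and
    \<open>j\<close> below is \<open>- \<delta>'\<close>.\<close>
  define n where "n = (a - 3) div 2"
  have a: "a = 2 * n + 3" using c1(1) unfolding n_def by presburger
  have "\<not> 3 dvd n" using c1(1) a by presburger
  then have "coprime 3 n" by (intro prime_imp_coprime) auto
  have cn: "c * n = 3 * d" using c1(2) a by simp
  then have "3 dvd c * n" by simp
  then have "3 dvd c" using \<open>coprime 3 n\<close> by (simp add: coprime_dvd_mult_left_iff)
  then obtain j where j: "c = 3 * j" by blast
  then have d: "d = n * j" using cn by (simp add: mult.commute)
  have j0: "1 \<le> j" using j assms(3) by simp
  then have "0 < n" using d assms(2) by (simp add: zero_less_mult_iff)
  have "2 * 1 \<le> k * j" using j0 assms(4) by (intro mult_mono) auto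
  have lshape: "aa_lshape k 3 1 n (n + 1) 0 (- j) a d c"
  proof unfold_locales
    show "coprime a d" by fact
  qed (use assms(1-4) j d a \<open>0 < n\<close> \<open>2 * 1 \<le> k * j\<close> in \<open>simp_all add: algebra_simps\<close>)
  show ?thesis by (rule aa_lshape.pseudo_symmetric_c[OF lshape, of 0]) auto
qed

lemma pseudo_symmetric_if_c2:
  assumes "0 < a" "0 < d" "0 < c" "2 \<le> k" "coprime a d"
    and lmn: "1 \<le> l" "1 \<le> m" "1 \<le> n"
    and c2: "a = (2 + l * k) * (n + 1) + 1" "c + (2 + l * k) * d = m * a"
      "l * (a + k * d) = c * n - 3 * d"
  shows "pseudo_symmetric (num_semigroup (aa_gens a d c k))"
proof -
  \<comment> \<open>Forced by \<delta> = \<open>- l\<close> and \<mu> =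
    \<open>\<delta> - \<delta>'\<close>.\<close>
  define \<delta>' where "\<delta>' = - l - m"
  have b1: "d * (k * l + 3) - c * n = a * - l" using c2(3) by (simp add: algebra_simps)
  have b2: "d * 1 - c * (n + 1) = a * \<delta>'"
    using b1 c2(2) by (simp add: \<delta>'_def algebra_simps)
  have det: "a = (k * l + 3) * (n + 1) - 1 * n" using c2(1) by (simp add: algebra_simps)
  note dc = lattice_coordinates[OF det b1 b2 assms(1)]
  have "k * 2 \<le> k * (l + m)" using lmn assms(4) by (intro mult_left_mono) auto
  then have neg: "1 + k * \<delta>' \<le> 0" using assms(4) by (simp add: \<delta>'_def algebra_simps)
  have "0 \<le> k * l" using lmn assms(4) by simp
  have lshape: "aa_lshape k (k * l + 3) 1 n (n + 1) (- l) \<delta>' a d c"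
  proof unfold_locales
    show "a = (k * l + 3) * (n + 1) - 1 * n" by (fact det)
    show "d = (n + 1) * - l - n * \<delta>'" "c = 1 * - l - (k * l + 3) * \<delta>'" by (fact dc)+
    show "coprime a d" by fact
    show "1 < k * l + 3" using \<open>0 \<le> k * l\<close> by linarith
    show "0 < k * l + 3 + k * - l" by simp
  qed (use assms(2-4) lmn(3) neg in simp_all)
  show ?thesis by (rule aa_lshape.pseudo_symmetric_c[OF lshape, of l]) (use lmn in auto)
qed

lemma pseudo_symmetric_if_d:
  assumes "0 < a" "0 < d" "0 < c" "2 \<le> k" "coprime a d"
    and lmv: "2 \<le> l" "1 \<le> m" "0 \<le> v"
    and eqs: "a = (v + 1) * (2 + (l - 2) * k) + (l * k + 1)"
      "c + (2 + (l - 2) * k) * d = m * a" "l * (a + k * d) = c * (v + 1) - d"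
  shows "pseudo_symmetric (num_semigroup (aa_gens a d c k))"
proof -
  define \<delta>' where "\<delta>' = - l - m"
  have b1: "d * (k * l + 1) - c * (v + 1) = a * - l" using eqs(3) by (simp add: algebra_simps)
  have b2: "d * (2 * k - 1) - c * (v + 2) = a * \<delta>'"
    using b1 eqs(2) by (simp add: \<delta>'_def algebra_simps)
  have det: "a = (k * l + 1) * (v + 2) - (2 * k - 1) * (v + 1)"
    using eqs(1) by (simp add: algebra_simps)
  note dc = lattice_coordinates[OF det b1 b2 assms(1)]
  have "k * 2 \<le> k * l" "k * 1 \<le> k * m" using lmv assms(4) by (intro mult_left_mono; simp)+
  moreover have "k * \<delta>' = - (k * l) - k * m" by (simp add: \<delta>'_def algebra_simps)
  ultimately have ineqs: "2 * k - 1 + k * \<delta>' \<le> 0" "2 * k - 1 < k * l + 1"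
    using assms(4) by linarith+
  have lshape: "aa_lshape k (k * l + 1) (2 * k - 1) (v + 1) (v + 2) (- l) \<delta>' a d c"
  proof unfold_locales
    show "a = (k * l + 1) * (v + 2) - (2 * k - 1) * (v + 1)" by (fact det)
    show "d = (v + 2) * - l - (v + 1) * \<delta>'" "c = (2 * k - 1) * - l - (k * l + 1) * \<delta>'" by (fact dc)+
    show "coprime a d" by fact
  qed (use assms(2-4) lmv(3) ineqs in simp_all)
  show ?thesis
    by (rule aa_lshape.pseudo_symmetric_d[OF lshape, of "l - 2"]) (use lmv in \<open>auto simp: algebra_simps\<close>)
qed

lemma pseudo_symmetric_if_e:
  assumes "0 < a" "0 < d" "0 < c" "2 \<le> k" "coprime a d"
    and q: "2 \<le> q" and cong: "[R0 = 2] (mod k)" "[s0 = 2] (mod k)"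
    and eqs: "a = (q - 1) * s0 + 1" "a + k * d = q * R0 + 2 * k - 1"
      "k * c = (R0 + 2 * k - 1) * (s0 - 1) + 2 * k - 1"
  shows "pseudo_symmetric (num_semigroup (aa_gens a d c k))"
proof -
  obtain m where m: "s0 = k * m + 2" using cong_add_multE[OF cong(2)] .
  obtain r where r: "R0 = k * r + 2" using cong_add_multE[OF cong(1)] .
  define \<delta> where "\<delta> = r - m"
  have R0: "R0 = s0 + k * \<delta>" using m r by (simp add: \<delta>_def algebra_simps)
  have "k * d = k * (q * \<delta> + (m + 2))"
    using eqs(1,2) R0 m by (simp add: algebra_simps)
  then have d: "d = q * \<delta> + (m + 2)" using assms(4) by simp
  have "k * c = k * ((s0 - 1) * \<delta> + s0 * (m + 2))"
    unfolding eqs(3) R0 m by (simp add: algebra_simps)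
  then have c: "c = (s0 - 1) * \<delta> + s0 * (m + 2)" using assms(4) by simp
  \<comment> \<open>A negative \<open>m\<close> gives \<open>s0 <= 0\<close>; then
    \<open>a > 0\<close> leaves only \<open>s0 = 0\<close>, and \<open>c > 0\<close> makes \<delta>
    negative, hence \<open>d < 0\<close>.\<close>
  have m0: "0 \<le> m"
  proof (rule ccontr)
    assume "\<not> 0 \<le> m"
    then have "k * m \<le> k * - 1" using assms(4) by (intro mult_left_mono) auto
    then have "s0 \<le> 0" using m assms(4) by simp
    moreover have "0 \<le> (q - 1) * s0" using eqs(1) assms(1) by simp
    then have "0 \<le> s0" using q by (simp add: zero_le_mult_iff)
    ultimately have "s0 = 0" by simp
    then have "\<delta> \<le> - 1" using c assms(3) by simp
    then have "q * \<delta> \<le> q * - 1" using q by (intro mult_left_mono) auto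
    then show False using d \<open>\<not> 0 \<le> m\<close> assms(2) q by simp
  qed
  have "0 \<le> k * m" using m0 assms(4) by simp
  \<comment> \<open>Otherwise \<open>r <= - 1\<close>, and
    \<open>d = q * (r - m) + m + 2 <= 2 - q - m <= 0\<close>.\<close>
  have R0_pos: "0 < R0"
  proof (rule ccontr)
    assume "\<not> 0 < R0"
    then have "k * r < 0" using r by simp
    then have "r \<le> - 1" using assms(4) by (simp add: mult_less_0_iff)
    then have "q * r \<le> q * - 1" using q by (intro mult_left_mono) auto
    moreover have "q * m \<ge> 2 * m" using q m0 by (intro mult_right_mono) auto
    ultimately show False using d assms(2) q m0 by (simp add: \<delta>_def algebra_simps)
  qed
  have lshape: "aa_lshape k s0 (s0 - 1) 1 q \<delta> (- (m + 2)) a d c"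
  proof unfold_locales
    show "coprime a d" by fact
  qed (use assms(1-4) q eqs(1) d c R0 R0_pos m \<open>0 \<le> k * m\<close> in \<open>simp_all add: algebra_simps\<close>)
  show ?thesis by (rule aa_lshape.pseudo_symmetric_e[OF lshape m0 _ m]) auto
qed

lemma pseudo_symmetric_if_f:
  assumes "0 < a" "0 < d" "0 < c" "2 \<le> k" "coprime a d"
    and q: "2 \<le> q" and cong: "[R0 = 2] (mod k)" "[s0 = 2] (mod k)" and ne: "s0 \<noteq> 2"
    and eqs: "a = (q - 1) * s0 + 3" "a + k * d = q * R0 + 1" "k * c = (R0 + 1) * (s0 - 3) + 3"
  shows "pseudo_symmetric (num_semigroup (aa_gens a d c k))"
proof -
  obtain m where m: "s0 = k * m + 2" using cong_add_multE[OF cong(2)] .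
  obtain r where r: "R0 = k * r + 2" using cong_add_multE[OF cong(1)] .
  define \<delta> where "\<delta> = r - m"
  have R0: "R0 = s0 + k * \<delta>" using m r by (simp add: \<delta>_def algebra_simps)
  have "k * d = k * (q * \<delta> + m)"
    using eqs(1,2) R0 m by (simp add: algebra_simps)
  then have d: "d = q * \<delta> + m" using assms(4) by simp
  have "k * c = k * ((s0 - 3) * \<delta> + s0 * m)"
    unfolding eqs(3) R0 m by (simp add: algebra_simps)
  then have c: "c = (s0 - 3) * \<delta> + s0 * m" using assms(4) by simp
  have "m \<noteq> 0" using m ne by auto
  \<comment> \<open>The value 0 is excluded by \<open>s0 \<noteq> 2\<close>. For negative
    \<open>m\<close>, \<open>d > 0\<close> forces \<open>\<delta> >= 1\<close> and
    \<open>a > 0\<close> forces \<open>s0 >= - 2\<close>, whence \<open>c <= 0\<close>.\<close>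
  have m1: "1 \<le> m"
  proof (rule ccontr)
    assume "\<not> 1 \<le> m"
    then have m_neg: "m \<le> - 1" using \<open>m \<noteq> 0\<close> by simp
    then have "k * m \<le> 2 * m" using assms(4) by (intro mult_right_mono_neg) auto
    moreover have "2 * m \<le> - 2" using m_neg by simp
    ultimately have s0: "s0 \<le> 0" "s0 \<le> 2 * m + 2" using m by linarith+
    have "1 \<le> \<delta>"
    proof (rule ccontr)
      assume "\<not> 1 \<le> \<delta>"
      then have "q * \<delta> \<le> 0" using q by (simp add: mult_le_0_iff)
      then show False using d m_neg assms(2) by simp
    qed
    have "- 2 \<le> s0"
    proof (rule ccontr)
      assume "\<not> - 2 \<le> s0"
      then have "(q - 1) * s0 \<le> (q - 1) * - 3" using q by (intro mult_left_mono) auto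
      then show False using eqs(1) assms(1) q by (simp add: algebra_simps)
    qed
    then have "s0 * m \<le> 4"
    proof -
      have "- s0 * - m \<le> 2 * 2" using \<open>- 2 \<le> s0\<close> s0 m_neg by (intro mult_mono) auto
      then show ?thesis by simp
    qed
    consider "s0 = 0" | "s0 = - 1" | "s0 = - 2" using s0(1) \<open>- 2 \<le> s0\<close> by linarith
    then show False
      by cases (use c \<open>1 \<le> \<delta>\<close> \<open>s0 * m \<le> 4\<close> assms(3) s0 in auto)
  qed
  have "k * 1 \<le> k * m" using m1 assms(4) by (intro mult_left_mono) auto
  then have "4 \<le> s0" using m assms(4) by linarith
  have R0_pos: "0 < R0"
  proof (rule ccontr)
    assume "\<not> 0 < R0"
    then have "k * r < 0" using r by simp
    then have "r \<le> - 1" using assms(4) by (simp add: mult_less_0_iff)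
    then have "q * r \<le> q * - 1" using q by (intro mult_left_mono) auto
    moreover have "q * m \<ge> 2 * m" using q m1 by (intro mult_right_mono) auto
    moreover have "q * \<delta> = q * r - q * m" by (simp add: \<delta>_def algebra_simps)
    ultimately show False using d assms(2) q m1 by linarith
  qed
  have lshape: "aa_lshape k s0 (s0 - 3) 1 q \<delta> (- m) a d c"
  proof unfold_locales
    show "coprime a d" by fact
  qed (use assms(1-4) q eqs(1) d c R0 R0_pos m \<open>4 \<le> s0\<close> in \<open>simp_all add: algebra_simps\<close>)
  show ?thesis by (rule aa_lshape.pseudo_symmetric_f[OF lshape m1 _ m]) auto
qed

text \<open>Case (a) is an equality of sets, so the presentation with \<open>k = 2\<close> and
  \<open>c = 3\<close> can stand in for the given one.\<close>

lemma pseudo_symmetric_three: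
  fixes d :: int
  assumes "0 < d" "coprime 3 d"
  shows "pseudo_symmetric (num_semigroup {3, 3 + d, 3 + 2 * d})"
proof -
  have lshape: "aa_lshape 2 3 0 0 1 d (- 1) 3 d 3"
    by unfold_locales (use assms in auto)
  have "pseudo_symmetric (num_semigroup (aa_gens 3 d 3 2))"
    by (rule aa_lshape.pseudo_symmetric_ab[OF lshape]) auto
  then show ?thesis
    using aa_lshape.S_eq_three[OF lshape] by simp
qed

theorem theorem10:
  fixes a d c k :: int
  assumes "a > 0" and "d > 0" and "c > 0" and "k \<ge> 2"
    and "Gcd ({a + i * d | i. 0 \<le> i \<and> i \<le> k} \<union> {c}) = 1"
  shows "pseudo_symmetric (num_semigroup ({a + i * d | i. 0 \<le> i \<and> i \<le> k} \<union> {c}))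
    \<longleftrightarrow> gcd a d = 1 \<and>
      ( num_semigroup ({a + i * d | i. 0 \<le> i \<and> i \<le> k} \<union> {c})
          = num_semigroup {3, 3 + d, 3 + 2 * d}
      \<or> (a * (c - 1) = 2 * (c + d) \<and> odd c)
      \<or> ((a mod 6 = 1 \<or> a mod 6 = 5) \<and> c * (a - 3) = 6 * d \<and> a \<le> 2 * k * d + 3)
      \<or> (\<exists>l m n :: int. l \<ge> 1 \<and> m \<ge> 1 \<and> n \<ge> 1 \<and>
           a = (2 + l * k) * (n + 1) + 1 \<and> c + (2 + l * k) * d = m * a \<and>
           l * (a + k * d) = c * n - 3 * d)
      \<or> (\<exists>l m v :: int. l \<ge> 2 \<and> m \<ge> 1 \<and> v \<ge> 0 \<and>
           a = (v + 1) * (2 + (l - 2) * k) + (l * k + 1) \<and>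
           c + (2 + (l - 2) * k) * d = m * a \<and>
           l * (a + k * d) = c * (v + 1) - d)
      \<or> (\<exists>q1 R0 s0 :: int. q1 \<ge> 2 \<and> [R0 = 2] (mod k) \<and> [s0 = 2] (mod k) \<and>
           a = (q1 - 1) * s0 + 1 \<and> a + k * d = q1 * R0 + 2 * k - 1 \<and>
           k * c = (R0 + 2 * k - 1) * (s0 - 1) + 2 * k - 1)
      \<or> (\<exists>q1 R0 s0 :: int. q1 \<ge> 2 \<and> [R0 = 2] (mod k) \<and> [s0 = 2] (mod k) \<and> s0 \<noteq> 2 \<and>
           a = (q1 - 1) * s0 + 3 \<and> a + k * d = q1 * R0 + 1 \<and>
           k * c = (R0 + 1) * (s0 - 3) + 3))" (is "_ \<longleftrightarrow> _ \<and> ?R")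
proof (rule iffI)
  assume ps: "pseudo_symmetric (num_semigroup (aa_gens a d c k))"
  have gcd: "gcd a d = 1" by (rule pseudo_symmetric_coprime[OF assms ps])
  then have cop: "coprime a d" by (simp only: coprime_iff_gcd_eq_1)
  obtain s s' P P' \<delta> \<delta>' where lshape: "aa_lshape k s s' P P' \<delta> \<delta>' a d c"
    by (rule aa_lshape_exists[OF assms(1-4) cop])
  have P: "0 \<le> P" "P < P'" by (fact aa_lshape.P[OF lshape])+
  have ?R
  proof (cases rule: aa_lshape.pseudo_symmetric_cases[OF lshape ps])
    case 1
    then have "num_semigroup (aa_gens a d c k) = num_semigroup {3, 3 + d, 3 + 2 * d}"
      by (rule aa_lshape.S_eq_three[OF lshape])
    then show ?thesis by (rule disjI1)
  next
    case 2
    then have "a * (c - 1) = 2 * (c + d) \<and> odd c" using aa_lshape.params_b[OF lshape] by blast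
    then show ?thesis by (intro disjI2[OF disjI1])
  next
    case (3 m)
    show ?thesis
    \<comment> \<open>Here \<open>m\<close> is \<lambda>, and (c.1) is the degenerate value
      0.\<close>
    proof (cases "m = 0")
      case True
      then have "s = 3" "\<delta> = 0" using 3 by simp_all
      note c1 = aa_lshape.params_c1[OF lshape 3(3,4) this]
      show ?thesis by (rule disjI2, rule disjI2, rule disjI1) (use c1 in blast)
    next
      case False
      then have "1 \<le> m" using 3(1) by simp
      then show ?thesis using aa_lshape.params_c2[OF lshape 3(1,3-6)] 3(2)
        by (intro disjI2[OF disjI2[OF disjI2[OF disjI1]]] exI conjI)
    qed
  next
    case (4 m)
    then have "2 \<le> m + 2" "0 \<le> P - 1" by simp_all
    then show ?thesis using aa_lshape.params_d[OF lshape 4(1,3-6)]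
      by (intro disjI2[OF disjI2[OF disjI2[OF disjI2[OF disjI1]]]] exI conjI)
  next
    case (5 m)
    have "[s + k * \<delta> = 2] (mod k)" "[s = 2] (mod k)" "2 \<le> P'"
      using 5 P by (simp_all add: cong_iff_dvd_diff algebra_simps)
    then show ?thesis using aa_lshape.params_e[OF lshape 5(2-5)]
      by (intro disjI2[OF disjI2[OF disjI2[OF disjI2[OF disjI2[OF disjI1]]]]] exI conjI)
  next
    case (6 m)
    have "[s + k * \<delta> = 2] (mod k)" "[s = 2] (mod k)" "2 \<le> P'" "s \<noteq> 2"
      using 6 P assms(4) by (simp_all add: cong_iff_dvd_diff algebra_simps)
    then show ?thesis using aa_lshape.params_f[OF lshape 6(2-5)]
      by (intro disjI2[OF disjI2[OF disjI2[OF disjI2[OF disjI2[OF disjI2]]]]] exI conjI)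
  qed
  with gcd show "gcd a d = 1 \<and> ?R" by (rule conjI)
next
  assume R: "gcd a d = 1 \<and> ?R"
  then have "coprime a d" by (simp only: coprime_iff_gcd_eq_1)
  note pos = assms(1-4) this
  from R have ?R by (rule conjunct2)
  then show "pseudo_symmetric (num_semigroup (aa_gens a d c k))"
  proof (elim disjE exE conjE)
    assume eq: "num_semigroup (aa_gens a d c k) = num_semigroup {3, 3 + d, 3 + 2 * d}"
    \<comment> \<open>If 3 divided \<open>d\<close>, it would divide every element of the common
      semigroup and so the \<open>Gcd\<close> of the given generators.\<close>
    have "coprime 3 d"
    proof (rule ccontr)
      assume "\<not> coprime 3 d"
      then have "3 dvd d" using prime_imp_coprime[of 3 d] by auto
      have "3 dvd Gcd (aa_gens a d c k)"
      proof (rule Gcd_greatest)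
        fix b assume "b \<in> aa_gens a d c k"
        then have "b \<in> num_semigroup {3, 3 + d, 3 + 2 * d}"
          unfolding eq[symmetric] by (rule num_semigroup_generator)
        then show "3 dvd b" by (rule num_semigroup_dvd) (use \<open>3 dvd d\<close> in auto)
      qed
      then show False unfolding assms(5) by simp
    qed
    with assms(2) show ?thesis unfolding eq by (rule pseudo_symmetric_three)
  qed (rule pseudo_symmetric_if_b[OF pos] pseudo_symmetric_if_c1[OF pos] pseudo_symmetric_if_c2[OF pos]
      pseudo_symmetric_if_d[OF pos] pseudo_symmetric_if_e[OF pos] pseudo_symmetric_if_f[OF pos],
      (assumption | rule disjI1, assumption | rule disjI2, assumption)+)+
qed

end
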